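(* Let $G$ be a finitely generated group and let $\mu$ be a non-degenerate probability measure on $G$. Suppose that $\mu$ has a finite exponential moment of some order $c>0$. Then $\lambda(G,\mu)=1$ if and only if $G$ is amenable and $\mu$ is centred.
   Context: A probability measure on a countable group $G$ is a function $\mu:G\to[0,\infty)$ with $\sum_{g\in G}\mu(g)=1$; its support is $S_\mu=\{g\in G:\mu(g)>0\}$ (not assumed finite). $\mu$ is non-degenerate if $S_\mu$ generates $G$ as a semigroup. Convolution is $\mu*\nu(g)=\sum_{s\in G}\mu(s)\nu(s^{-1}g)$, and $\mu^{*n}$ denotes the $n$-fold convolution power. The spectral radius is $\lambda(G,\mu)=\limsup_{n\to\infty}(\mu^{*n}(e))^{1/n}$, where $e$ is the identity. Let $|\cdot|$ be the word metric on $G$ associated to some finite generating set (not assumed related to $S_\mu$). $\mu$ has finite exponential moment of order $c>0$ if $\sum_{g\in G}e^{c|g|}\mu(g)<\infty$, and finite first moment if $\sum_{g\in G}|g|\mu(g)<\infty$. A probability measure $\mu$ with finite first moment is centred if $\sum_{g\in G}\chi(g)\mu(g)=0$ for every homomorphism $\chi:G\to\mathbb{R}$. $G$ is amenable if there is a linear functional $M:\ell^\infty(G)\to\mathbb{R}$ with $M(1)=1$, $\inf_{g} f(g)\le M(f)\le\sup_{g} f(g)$, and $M(f_g)=M(f)$ for all $g\in G$, where $f_g(x)=f(gx)$. *)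

theory Defs
  imports "HOL-Analysis.Elementary_Metric_Spaces" "HOL-Analysis.Infinite_Sum" "HOL-Algebra.Generated_Groups"
begin

text \<open>A measure on \<open>G\<close> is a function \<open>\<mu> :: 'a \<Rightarrow> real\<close>. Only its values on
  \<open>carrier G\<close> are ever used. Infinite sums are unordered sums over \<open>carrier G\<close>.\<close>

definition prob_measure_on :: "('a, 'b) monoid_scheme \<Rightarrow> ('a \<Rightarrow> real) \<Rightarrow> bool" where
  "prob_measure_on G \<mu> \<longleftrightarrow> (\<forall>g\<in>carrier G. 0 \<le> \<mu> g) \<and> (\<mu> has_sum 1) (carrier G)"

definition measure_support :: "('a, 'b) monoid_scheme \<Rightarrow> ('a \<Rightarrow> real) \<Rightarrow> 'a set" where
  "measure_support G \<mu> = {g \<in> carrier G. \<mu> g > 0}"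

inductive_set semigroup_generated :: "('a, 'b) monoid_scheme \<Rightarrow> 'a set \<Rightarrow> 'a set"
  for G and A where
    incl: "a \<in> A \<Longrightarrow> a \<in> semigroup_generated G A"
  | mult: "a \<in> semigroup_generated G A \<Longrightarrow> b \<in> semigroup_generated G A
      \<Longrightarrow> a \<otimes>\<^bsub>G\<^esub> b \<in> semigroup_generated G A"

definition nondegenerate :: "('a, 'b) monoid_scheme \<Rightarrow> ('a \<Rightarrow> real) \<Rightarrow> bool" where
  "nondegenerate G \<mu> \<longleftrightarrow> semigroup_generated G (measure_support G \<mu>) = carrier G"

definition convolution ::
    "('a, 'b) monoid_scheme \<Rightarrow> ('a \<Rightarrow> real) \<Rightarrow> ('a \<Rightarrow> real) \<Rightarrow> 'a \<Rightarrow> real" where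
  "convolution G \<mu> \<nu> g = (\<Sum>\<^sub>\<infinity>s\<in>carrier G. \<mu> s * \<nu> (inv\<^bsub>G\<^esub> s \<otimes>\<^bsub>G\<^esub> g))"

primrec convolution_power ::
    "('a, 'b) monoid_scheme \<Rightarrow> ('a \<Rightarrow> real) \<Rightarrow> nat \<Rightarrow> 'a \<Rightarrow> real" where
  "convolution_power G \<mu> 0 = (\<lambda>g. if g = \<one>\<^bsub>G\<^esub> then 1 else 0)"
| "convolution_power G \<mu> (Suc n) = convolution G \<mu> (convolution_power G \<mu> n)"

text \<open>The limsup is taken in the extended reals, where it always exists. The term
  at \<open>n = 0\<close> (where \<open>root 0 x = 0\<close>) does not affect it.\<close>

definition spectral_radius :: "('a, 'b) monoid_scheme \<Rightarrow> ('a \<Rightarrow> real) \<Rightarrow> ereal" where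
  "spectral_radius G \<mu> = limsup (\<lambda>n. ereal (root n (convolution_power G \<mu> n \<one>\<^bsub>G\<^esub>)))"

definition finite_generating_set :: "('a, 'b) monoid_scheme \<Rightarrow> 'a set \<Rightarrow> bool" where
  "finite_generating_set G S \<longleftrightarrow> finite S \<and> S \<subseteq> carrier G \<and> generate G S = carrier G"

text \<open>\<open>S\<close> need not be symmetric, so words are in the letters of \<open>S\<close> and their inverses.
  When \<open>S\<close> generates \<open>G\<close>, every \<open>g \<in> carrier G\<close> is represented by such a word, so the
  \<open>LEAST\<close> is attained.\<close>

definition word_length :: "('a, 'b) monoid_scheme \<Rightarrow> 'a set \<Rightarrow> 'a \<Rightarrow> nat" where
  "word_length G S g = (LEAST n. \<exists>ws. length ws = n \<and> set ws \<subseteq> S \<union> m_inv G ` S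
      \<and> g = foldr (\<otimes>\<^bsub>G\<^esub>) ws \<one>\<^bsub>G\<^esub>)"

definition finite_exponential_moment ::
    "('a, 'b) monoid_scheme \<Rightarrow> 'a set \<Rightarrow> ('a \<Rightarrow> real) \<Rightarrow> real \<Rightarrow> bool" where
  "finite_exponential_moment G S \<mu> c \<longleftrightarrow>
     (\<lambda>g. exp (c * real (word_length G S g)) * \<mu> g) summable_on carrier G"

definition finite_first_moment ::
    "('a, 'b) monoid_scheme \<Rightarrow> 'a set \<Rightarrow> ('a \<Rightarrow> real) \<Rightarrow> bool" where
  "finite_first_moment G S \<mu> \<longleftrightarrow>
     (\<lambda>g. real (word_length G S g) * \<mu> g) summable_on carrier G"

definition real_additive_group :: "real monoid" where
  "real_additive_group = \<lparr>carrier = UNIV, monoid.mult = (+), one = 0\<rparr>"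

definition centred :: "('a, 'b) monoid_scheme \<Rightarrow> 'a set \<Rightarrow> ('a \<Rightarrow> real) \<Rightarrow> bool" where
  "centred G S \<mu> \<longleftrightarrow> finite_first_moment G S \<mu> \<and>
     (\<forall>\<phi>\<in>hom G real_additive_group. ((\<lambda>g. \<phi> g * \<mu> g) has_sum 0) (carrier G))"

text \<open>Elements of \<open>bounded_functions G\<close> are total functions, arbitrary off \<open>carrier G\<close>.
  A mean cannot see those values: if \<open>f\<close> and \<open>h\<close> agree on \<open>carrier G\<close>, linearity and the
  two bounds applied to \<open>f - h\<close> give \<open>M f = M h\<close>.\<close>

definition bounded_functions :: "('a, 'b) monoid_scheme \<Rightarrow> ('a \<Rightarrow> real) set" where
  "bounded_functions G = {f. bounded (f ` carrier G)}"

definition invariant_mean ::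
    "('a, 'b) monoid_scheme \<Rightarrow> (('a \<Rightarrow> real) \<Rightarrow> real) \<Rightarrow> bool" where
  "invariant_mean G M \<longleftrightarrow>
     (\<forall>f\<in>bounded_functions G. \<forall>h\<in>bounded_functions G. M (\<lambda>x. f x + h x) = M f + M h) \<and>
     (\<forall>a. \<forall>f\<in>bounded_functions G. M (\<lambda>x. a * f x) = a * M f) \<and>
     M (\<lambda>x. 1) = 1 \<and>
     (\<forall>f\<in>bounded_functions G. (INF x\<in>carrier G. f x) \<le> M f \<and> M f \<le> (SUP x\<in>carrier G. f x)) \<and>
     (\<forall>f\<in>bounded_functions G. \<forall>g\<in>carrier G. M (\<lambda>x. f (g \<otimes>\<^bsub>G\<^esub> x)) = M f)"

definition amenable :: "('a, 'b) monoid_scheme \<Rightarrow> bool" where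
  "amenable G \<longleftrightarrow> (\<exists>M. invariant_mean G M)"

end

theory Submission
  imports Defs "HOL-Analysis.Function_Topology"
begin

text \<open>
  Write \<open>p n\<close> for the \<open>n\<close>-fold convolution power.

  If \<open>\<lambda> < 1\<close>, then \<open>h = (\<Sum>n. t ^ n * p n)\<close> is finite for some \<open>t > 1\<close> and satisfies
  \<open>(\<Sum>s. \<mu> s * h (s\<inverse> g)) \<le> h g / t\<close>. An invariant mean \<open>M\<close> turns the cocycle
  \<open>ln (h (s\<inverse> g) / h g)\<close>, bounded in \<open>g\<close> by Harnack's inequality, into a homomorphism \<open>\<phi>\<close>.
  Applying \<open>M\<close> to \<open>ln x \<le> x - 1\<close> gives \<open>(\<Sum>s. \<phi> s * \<mu> s) \<le> 1 / t - 1 < 0\<close>, so \<open>\<mu>\<close> is not centred.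

  If \<open>\<phi>\<close> is a homomorphism with \<open>(\<Sum>s. \<phi> s * \<mu> s) < 0\<close>, then \<open>\<rho> = (\<Sum>s. exp (t * \<phi> s) * \<mu> s) < 1\<close>
  for some small \<open>t > 0\<close>, and \<open>exp (t * \<phi> g) * p n g \<le> \<rho> ^ n\<close> forces \<open>\<lambda> < 1\<close>.

  If \<open>\<lambda> = 1\<close>, then for every \<open>t > 1\<close> the truncated Green functions \<open>u = (\<Sum>n\<le>N. t ^ n * p n)\<close> are
  unbounded at the identity as \<open>N\<close> grows. Pairing \<open>u \<le> \<delta> + t * (\<mu> * u)\<close> with \<open>u\<close> in \<open>\<ell>\<^sup>2\<close> shows that
  \<open>\<langle>u, \<mu> * u\<rangle> / \<parallel>u\<parallel>\<^sup>2\<close> is close to \<open>1\<close>, so the normalised \<open>u\<close> is almost invariant under the support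
  of \<open>\<mu>\<close>. The squares of these functions are weights whose cluster points are invariant means.
\<close>

section \<open>Unordered sums\<close>

lemma has_sum_finite_sum:
  fixes f :: "'i \<Rightarrow> 'a \<Rightarrow> real"
  assumes "finite I" "\<And>i. i \<in> I \<Longrightarrow> (f i has_sum S i) A"
  shows "((\<lambda>x. \<Sum>i\<in>I. f i x) has_sum (\<Sum>i\<in>I. S i)) A"
  using assms by (induction I rule: finite_induct) (auto intro!: has_sum_add)

lemma summable_on_of_finite_sums_le:
  fixes f :: "'a \<Rightarrow> real"
  assumes "\<And>x. x \<in> A \<Longrightarrow> 0 \<le> f x" "\<And>F. finite F \<Longrightarrow> F \<subseteq> A \<Longrightarrow> sum f F \<le> B"
  shows "f summable_on A"
  using assms by (intro nonneg_bdd_above_summable_on) (auto intro!: bdd_aboveI2[where M = B])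

section \<open>Bounded functions and means\<close>

lemma bounded_functions_iff:
  "f \<in> bounded_functions G \<longleftrightarrow> (\<exists>B. \<forall>x\<in>carrier G. \<bar>f x\<bar> \<le> B)"
  by (simp add: bounded_functions_def bounded_iff)

lemma bounded_functions_add:
  assumes "f \<in> bounded_functions G" "h \<in> bounded_functions G"
  shows "(\<lambda>x. f x + h x) \<in> bounded_functions G"
  using assms unfolding bounded_functions_iff by (meson abs_triangle_ineq add_mono order_trans)

lemma bounded_functions_cmult:
  assumes "f \<in> bounded_functions G"
  shows "(\<lambda>x. a * f x) \<in> bounded_functions G"
  using assms unfolding bounded_functions_iff by (metis abs_ge_zero abs_mult mult_left_mono)

lemma bounded_functions_sum:
  assumes "finite A" "\<And>i. i \<in> A \<Longrightarrow> f i \<in> bounded_functions G"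
  shows "(\<lambda>x. \<Sum>i\<in>A. a i * f i x) \<in> bounded_functions G"
  using assms
proof (induction A rule: finite_induct)
  case empty
  then show ?case by (auto simp: bounded_functions_iff)
next
  case (insert i A)
  then show ?case
    by (simp add: bounded_functions_add bounded_functions_cmult)
qed

text \<open>Invariance is split off because the mean constructed below is first known to be
  invariant only under a subset of the group, and linearity and monotonicity are needed before that
  is extended.\<close>

definition is_mean :: "('a, 'b) monoid_scheme \<Rightarrow> (('a \<Rightarrow> real) \<Rightarrow> real) \<Rightarrow> bool" where
  "is_mean G M \<longleftrightarrow>
     (\<forall>f\<in>bounded_functions G. \<forall>h\<in>bounded_functions G. M (\<lambda>x. f x + h x) = M f + M h) \<and>
     (\<forall>a. \<forall>f\<in>bounded_functions G. M (\<lambda>x. a * f x) = a * M f) \<and>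
     M (\<lambda>x. 1) = 1 \<and>
     (\<forall>f\<in>bounded_functions G. (INF x\<in>carrier G. f x) \<le> M f \<and> M f \<le> (SUP x\<in>carrier G. f x))"

lemma invariant_mean_iff:
  "invariant_mean G M \<longleftrightarrow> is_mean G M \<and>
     (\<forall>f\<in>bounded_functions G. \<forall>g\<in>carrier G. M (\<lambda>x. f (g \<otimes>\<^bsub>G\<^esub> x)) = M f)"
  unfolding invariant_mean_def is_mean_def by blast

context
  fixes G :: "('a, 'b) monoid_scheme" and M
  assumes M: "is_mean G M"
begin

lemma mean_add:
  "f \<in> bounded_functions G \<Longrightarrow> h \<in> bounded_functions G \<Longrightarrow> M (\<lambda>x. f x + h x) = M f + M h"
  using M by (auto simp: is_mean_def)

lemma mean_cmult: "f \<in> bounded_functions G \<Longrightarrow> M (\<lambda>x. a * f x) = a * M f"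
  using M by (auto simp: is_mean_def)

lemma mean_const: "M (\<lambda>x. a) = a"
  using mean_cmult[of "\<lambda>x. 1" a] M by (auto simp: is_mean_def bounded_functions_iff)

lemma mean_sum:
  assumes "finite A" "\<And>i. i \<in> A \<Longrightarrow> f i \<in> bounded_functions G"
  shows "M (\<lambda>x. \<Sum>i\<in>A. a i * f i x) = (\<Sum>i\<in>A. a i * M (f i))"
  using assms
proof (induction A rule: finite_induct)
  case empty
  then show ?case by (simp add: mean_const)
next
  case (insert i A)
  then show ?case
    by (simp add: mean_add mean_cmult bounded_functions_cmult bounded_functions_sum)
qed

text \<open>The lower bound by the infimum, applied to \<open>h - f\<close>. Non-emptiness matters
  because the infimum of the empty set of reals is unspecified.\<close>

lemma mean_mono:
  assumes f: "f \<in> bounded_functions G" and h: "h \<in> bounded_functions G"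
    and le: "\<And>x. x \<in> carrier G \<Longrightarrow> f x \<le> h x" and ne: "carrier G \<noteq> {}"
  shows "M f \<le> M h"
proof -
  have *: "(\<lambda>x. h x + (-1) * f x) \<in> bounded_functions G"
    using f h by (intro bounded_functions_add bounded_functions_cmult)
  have "0 \<le> (INF x\<in>carrier G. h x + (-1) * f x)"
    using le ne by (intro cINF_greatest) auto
  also have "\<dots> \<le> M (\<lambda>x. h x + (-1) * f x)"
    using M * unfolding is_mean_def by blast
  also have "\<dots> = M h + (-1) * M f"
    using mean_add[OF h bounded_functions_cmult[OF f, of "-1"]] mean_cmult[OF f, of "-1"] by simp
  finally show ?thesis by simp
qed

text \<open>Identities that rest on the group laws hold only on \<open>carrier G\<close>, whereas
  \<open>M\<close> takes total functions, so such identities cannot be rewritten under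
  \<open>M\<close> directly.\<close>

lemma mean_cong:
  assumes "f \<in> bounded_functions G" "h \<in> bounded_functions G"
    and "\<And>x. x \<in> carrier G \<Longrightarrow> f x = h x" and "carrier G \<noteq> {}"
  shows "M f = M h"
  using assms by (intro antisym mean_mono) auto

end

section \<open>Words in the generators\<close>

text \<open>The \<open>LEAST\<close> is meaningful once some word for \<open>g\<close> exists.
  Induction over \<open>generate\<close> provides one, with concatenation of words for
  products.\<close>

lemma (in group) word_length_attained:
  assumes S: "finite_generating_set G S" and g: "g \<in> carrier G"
  shows "\<exists>ws. length ws = word_length G S g \<and> set ws \<subseteq> S \<union> m_inv G ` S \<and> g = foldr (\<otimes>) ws \<one>"
  unfolding word_length_def
proof (rule LeastI_ex)
  have S': "S \<subseteq> carrier G" "generate G S = carrier G"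
    using S by (auto simp: finite_generating_set_def)
  have closed: "foldr (\<otimes>) ws \<one> \<in> carrier G" if "set ws \<subseteq> S \<union> m_inv G ` S" for ws
    using that S' by (induction ws) auto
  have append: "foldr (\<otimes>) (vs @ ws) \<one> = foldr (\<otimes>) vs \<one> \<otimes> foldr (\<otimes>) ws \<one>"
    if "set vs \<subseteq> S \<union> m_inv G ` S" "set ws \<subseteq> S \<union> m_inv G ` S" for vs ws
    using that
  proof (induction vs)
    case Nil
    then show ?case using closed by simp
  next
    case (Cons s vs)
    moreover have "s \<in> carrier G"
      using Cons.prems S' by auto
    ultimately show ?case using closed by (simp add: m_assoc)
  qed
  have "g \<in> generate G S"
    using g S' by simp
  then have "\<exists>ws. set ws \<subseteq> S \<union> m_inv G ` S \<and> g = foldr (\<otimes>) ws \<one>"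
  proof induction
    case one
    show ?case by (rule exI[of _ "[]"]) simp
  next
    case (incl h)
    then show ?case using S' by (intro exI[of _ "[h]"]) auto
  next
    case (inv h)
    then show ?case using S' by (intro exI[of _ "[inv h]"]) auto
  next
    case (eng h1 h2)
    then show ?case
      using append by (metis Un_least set_append)
  qed
  then show "\<exists>n ws. length ws = n \<and> set ws \<subseteq> S \<union> m_inv G ` S \<and> g = foldr (\<otimes>) ws \<one>"
    by blast
qed

section \<open>Invariant means as cluster points of weights\<close>

lemma (in group) bij_betw_translation:
  assumes "a \<in> carrier G"
  shows "bij_betw (\<lambda>g. a \<otimes> g) (carrier G) (carrier G)"
  by (rule bij_betwI[where g = "\<lambda>g. inv a \<otimes> g"]) (use assms in \<open>auto simp: m_assoc[symmetric]\<close>)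

text \<open>Integration against each weight is a mean. By Tychonoff these means have a cluster point
  in the topology of pointwise convergence. The properties of a mean survive pointwise limits, and
  the error of invariance under \<open>s\<close> is at most a constant times
  \<open>d k\<close>.\<close>

lemma (in group) mean_of_almost_invariant_weights:
  fixes w :: "nat \<Rightarrow> 'a \<Rightarrow> real"
  assumes A: "A \<subseteq> carrier G"
    and nonneg: "\<And>k g. g \<in> carrier G \<Longrightarrow> 0 \<le> w k g"
    and total: "\<And>k. (w k has_sum 1) (carrier G)"
    and almost: "\<And>s. s \<in> A \<Longrightarrow> \<exists>d. d \<longlonglongrightarrow> 0 \<and>
      (\<forall>k. (\<lambda>g. \<bar>w k (inv s \<otimes> g) - w k g\<bar>) summable_on carrier G \<and>
        (\<Sum>\<^sub>\<infinity>g\<in>carrier G. \<bar>w k (inv s \<otimes> g) - w k g\<bar>) \<le> d k)"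
  obtains M where "is_mean G M"
    and "\<And>s F. s \<in> A \<Longrightarrow> F \<in> bounded_functions G \<Longrightarrow> M (\<lambda>x. F (s \<otimes> x)) = M F"
proof -
  let ?BF = "bounded_functions G"
  \<comment> \<open>The value 0 at unbounded \<open>F\<close> confines every coordinate of
    \<open>m k\<close> to a compact interval.\<close>
  define m where "m k F = (if F \<in> ?BF then \<Sum>\<^sub>\<infinity>g\<in>carrier G. F g * w k g else 0)" for k F
  have m: "((\<lambda>g. F g * w k g) has_sum m k F) (carrier G)" if F: "F \<in> ?BF" for k F
  proof -
    obtain B where B: "\<And>g. g \<in> carrier G \<Longrightarrow> \<bar>F g\<bar> \<le> B"
      using F by (auto simp: bounded_functions_iff)
    have "(\<lambda>g. F g * w k g) abs_summable_on carrier G"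
    proof (rule summable_on_comparison_test)
      show "(\<lambda>g. B * w k g) summable_on carrier G"
        using has_sum_imp_summable[OF total] by (rule summable_on_cmult_right)
      show "norm (F g * w k g) \<le> B * w k g" if "g \<in> carrier G" for g
        using B[OF that] nonneg[OF that] by (auto simp: abs_mult intro: mult_right_mono)
    qed simp
    then show ?thesis
      using F by (simp add: m_def abs_summable_summable)
  qed
  have m_le: "m k F \<le> b" if "F \<in> ?BF" "\<And>g. g \<in> carrier G \<Longrightarrow> F g \<le> b" for k F b
    using has_sum_mono[OF m[OF that(1), of k] has_sum_cmult_right[OF total[of k], of b]] that nonneg
    by (simp add: mult_right_mono)
  have m_ge: "b \<le> m k F" if "F \<in> ?BF" "\<And>g. g \<in> carrier G \<Longrightarrow> b \<le> F g" for k F b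
    using has_sum_mono[OF has_sum_cmult_right[OF total[of k], of b] m[OF that(1), of k]] that nonneg
    by (simp add: mult_right_mono)
  have "\<exists>B. F \<in> ?BF \<longrightarrow> (\<forall>g\<in>carrier G. \<bar>F g\<bar> \<le> B)" for F
    by (auto simp: bounded_functions_iff)
  then obtain B where B: "\<And>F g. F \<in> ?BF \<Longrightarrow> g \<in> carrier G \<Longrightarrow> \<bar>F g\<bar> \<le> B F"
    by metis
  \<comment> \<open>Nothing is known about \<open>B F\<close> for unbounded \<open>F\<close>; the
    absolute value ensures that the interval contains 0.\<close>
  define K where "K = (PiE UNIV (\<lambda>F. {- \<bar>B F\<bar>..\<bar>B F\<bar>}) :: (('a \<Rightarrow> real) \<Rightarrow> real) set)"
  have "compactin (product_topology (\<lambda>_. euclidean) UNIV) K"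
    unfolding K_def by (subst compactin_PiE) auto
  then have "compact K"
    by (simp add: euclidean_product_topology)
  have m_K: "m k \<in> K" for k
  proof -
    have "- \<bar>B F\<bar> \<le> m k F \<and> m k F \<le> \<bar>B F\<bar>" for F
    proof (cases "F \<in> ?BF")
      case True
      then have "\<bar>F g\<bar> \<le> \<bar>B F\<bar>" if "g \<in> carrier G" for g
        using B[OF True that] by linarith
      then show ?thesis
        using True by (auto intro!: m_le m_ge simp: abs_le_iff minus_le_iff)
    qed (simp add: m_def)
    then show ?thesis
      by (auto simp: K_def)
  qed
  obtain M where M: "inf (nhds M) (filtermap m sequentially) \<noteq> bot"
    using compact_filter[THEN iffD1, rule_format, OF \<open>compact K\<close>, of "filtermap m sequentially"] m_K
    by (auto simp: eventually_filtermap filtermap_bot_iff)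
  \<comment> \<open>Compactness yields a cluster point but no convergent subsequence. The filter
    \<open>U\<close> takes the place of a subnet: it is finer than \<open>sequentially\<close>, and
    \<open>m\<close> converges to \<open>M\<close> along it.\<close>
  define U where "U = inf sequentially (filtercomap m (nhds M))"
  have "U \<noteq> bot"
  proof
    assume "U = bot"
    then have "eventually (\<lambda>_. False) U"
      by simp
    then obtain P R where P: "eventually P sequentially" and R: "eventually R (filtercomap m (nhds M))"
      and PR: "\<And>k. P k \<Longrightarrow> R k \<Longrightarrow> False"
      unfolding U_def eventually_inf by blast
    from R obtain Q where Q: "eventually Q (nhds M)" and QR: "\<And>k. Q (m k) \<Longrightarrow> R k"
      unfolding eventually_filtercomap by blast
    from P have "eventually (\<lambda>x. \<not> Q x) (filtermap m sequentially)"
      unfolding eventually_filtermap by eventually_elim (use PR QR in blast)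
    with Q have "inf (nhds M) (filtermap m sequentially) = bot"
      unfolding trivial_limit_def eventually_inf by blast
    with M show False by contradiction
  qed
  have "(m \<longlongrightarrow> M) U"
    unfolding U_def using filterlim_filtercomap by (rule filterlim_mono) auto
  then have lim: "((\<lambda>k. m k F) \<longlongrightarrow> M F) U" for F
    by (rule tendsto_compose[rotated])
       (metis continuous_on_product_coordinates continuous_on_def UNIV_I)
  have U_le: "(f \<longlongrightarrow> l) U" if "f \<longlonglongrightarrow> l" for f :: "nat \<Rightarrow> real" and l
    using that unfolding U_def by (rule tendsto_mono[rotated]) simp
  note unique = tendsto_unique[OF \<open>U \<noteq> bot\<close>]
  show thesis
  proof (rule that)
    show "is_mean G M"
      unfolding is_mean_def
    proof (intro conjI ballI allI)
      fix f h assume fh: "f \<in> ?BF" "h \<in> ?BF"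
      have "m k (\<lambda>x. f x + h x) = m k f + m k h" for k
        using has_sum_add[OF m[OF fh(1), of k] m[OF fh(2), of k]]
        by (intro has_sum_unique[OF m[OF bounded_functions_add[OF fh]]]) (simp add: distrib_right)
      then show "M (\<lambda>x. f x + h x) = M f + M h"
        using unique[OF lim[of "\<lambda>x. f x + h x"]] tendsto_add[OF lim[of f] lim[of h]] by simp
    next
      fix a f assume f: "f \<in> ?BF"
      have "m k (\<lambda>x. a * f x) = a * m k f" for k
        using has_sum_cmult_right[OF m[OF f, of k], of a]
        by (intro has_sum_unique[OF m[OF bounded_functions_cmult[OF f]]]) (simp add: mult.assoc)
      then show "M (\<lambda>x. a * f x) = a * M f"
        using unique[OF lim[of "\<lambda>x. a * f x"]] tendsto_mult_left[OF lim[of f], of a] by simp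
    next
      have one: "(\<lambda>x. 1) \<in> ?BF"
        by (auto simp: bounded_functions_iff)
      have "m k (\<lambda>x. 1) = 1" for k
        using m[OF one, of k] total[of k] by (simp add: has_sum_unique)
      then show "M (\<lambda>x. 1) = 1"
        using unique[OF lim[of "\<lambda>x. 1"], of 1] by simp
    next
      fix f assume f: "f \<in> ?BF"
      have bdd: "bdd_above (f ` carrier G)" "bdd_below (f ` carrier G)"
        using f by (auto simp: bounded_functions_def bounded_imp_bdd_above bounded_imp_bdd_below)
      show "(INF x\<in>carrier G. f x) \<le> M f"
        using bdd(2) f by (intro tendsto_lowerbound[OF lim _ \<open>U \<noteq> bot\<close>] always_eventually allI m_ge cINF_lower) auto
      show "M f \<le> (SUP x\<in>carrier G. f x)"
        using bdd(1) f by (intro tendsto_upperbound[OF lim _ \<open>U \<noteq> bot\<close>] always_eventually allI m_le cSUP_upper) auto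
    qed
    fix s F assume s: "s \<in> A" and F: "F \<in> ?BF"
    have sG: "s \<in> carrier G"
      using s A by auto
    have Fs: "(\<lambda>x. F (s \<otimes> x)) \<in> ?BF"
      using F sG by (auto simp: bounded_functions_iff)
    obtain d where d: "d \<longlonglongrightarrow> 0"
      and diff: "\<And>k. (\<lambda>g. \<bar>w k (inv s \<otimes> g) - w k g\<bar>) summable_on carrier G"
        "\<And>k. (\<Sum>\<^sub>\<infinity>g\<in>carrier G. \<bar>w k (inv s \<otimes> g) - w k g\<bar>) \<le> d k"
      using almost[OF s] by blast
    have bound: "\<bar>m k (\<lambda>x. F (s \<otimes> x)) - m k F\<bar> \<le> \<bar>B F\<bar> * d k" for k
    proof -
      \<comment> \<open>The substitution of \<open>s \<otimes> g\<close> for \<open>g\<close> moves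
        the translation from \<open>F\<close> onto the weight.\<close>
      have "((\<lambda>g. F (s \<otimes> g) * w k (inv s \<otimes> (s \<otimes> g))) has_sum m k (\<lambda>x. F (s \<otimes> x))) (carrier G)"
        using m[OF Fs, of k] sG by (simp add: m_assoc[symmetric] cong: has_sum_cong)
      then have "((\<lambda>g. F g * w k (inv s \<otimes> g)) has_sum m k (\<lambda>x. F (s \<otimes> x))) (carrier G)"
        using has_sum_reindex_bij_betw[OF bij_betw_translation[OF sG], of "\<lambda>g. F g * w k (inv s \<otimes> g)"]
        by simp
      from has_sum_add[OF this has_sum_uminusI[OF m[OF F, of k]]]
      have "((\<lambda>g. F g * (w k (inv s \<otimes> g) - w k g)) has_sum m k (\<lambda>x. F (s \<otimes> x)) - m k F) (carrier G)"
        by (simp add: right_diff_distrib)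
      moreover have "((\<lambda>g. \<bar>B F\<bar> * \<bar>w k (inv s \<otimes> g) - w k g\<bar>) has_sum
          \<bar>B F\<bar> * (\<Sum>\<^sub>\<infinity>g\<in>carrier G. \<bar>w k (inv s \<otimes> g) - w k g\<bar>)) (carrier G)"
        using diff(1) by (intro has_sum_cmult_right has_sum_infsum)
      ultimately have "norm (m k (\<lambda>x. F (s \<otimes> x)) - m k F)
          \<le> \<bar>B F\<bar> * (\<Sum>\<^sub>\<infinity>g\<in>carrier G. \<bar>w k (inv s \<otimes> g) - w k g\<bar>)"
      proof (rule norm_infsum_le)
        fix g assume g: "g \<in> carrier G"
        have "\<bar>F g\<bar> \<le> \<bar>B F\<bar>"
          using B[OF F g] by linarith
        then show "norm (F g * (w k (inv s \<otimes> g) - w k g)) \<le> \<bar>B F\<bar> * \<bar>w k (inv s \<otimes> g) - w k g\<bar>"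
          by (auto simp: abs_mult intro: mult_right_mono)
      qed
      also have "\<dots> \<le> \<bar>B F\<bar> * d k"
        using diff(2) by (intro mult_left_mono) auto
      finally show ?thesis by simp
    qed
    have "(\<lambda>k. \<bar>m k (\<lambda>x. F (s \<otimes> x)) - m k F\<bar>) \<longlonglongrightarrow> 0"
    proof (rule tendsto_sandwich[where f = "\<lambda>_. 0"])
      show "\<forall>\<^sub>F k in sequentially. \<bar>m k (\<lambda>x. F (s \<otimes> x)) - m k F\<bar> \<le> \<bar>B F\<bar> * d k"
        using bound by (rule always_eventually[OF allI])
      show "(\<lambda>k. \<bar>B F\<bar> * d k) \<longlonglongrightarrow> 0"
        using tendsto_mult_left[OF d, of "\<bar>B F\<bar>"] by (simp only: mult_zero_right)
      show "(\<lambda>_. 0 :: real) \<longlonglongrightarrow> 0"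
        by (rule tendsto_const)
      show "\<forall>\<^sub>F k in sequentially. 0 \<le> \<bar>m k (\<lambda>x. F (s \<otimes> x)) - m k F\<bar>"
        by (rule always_eventually) simp
    qed
    then have "(\<lambda>k. m k (\<lambda>x. F (s \<otimes> x)) - m k F) \<longlonglongrightarrow> 0"
      by (rule tendsto_rabs_zero_cancel)
    from unique[OF U_le[OF this] tendsto_diff[OF lim lim]] show "M (\<lambda>x. F (s \<otimes> x)) = M F"
      by simp
  qed
qed

section \<open>Convolution powers of a non-degenerate measure\<close>

locale random_walk = group G for G (structure) +
  fixes \<mu> :: "'a \<Rightarrow> real"
  assumes prob: "prob_measure_on G \<mu>" and nondeg: "nondegenerate G \<mu>"
begin

abbreviation p :: "nat \<Rightarrow> 'a \<Rightarrow> real" where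
  "p \<equiv> convolution_power G \<mu>"

lemma mu_nonneg: "g \<in> carrier G \<Longrightarrow> 0 \<le> \<mu> g"
  using prob by (auto simp: prob_measure_on_def)

lemma mu_has_sum: "(\<mu> has_sum 1) (carrier G)"
  using prob by (auto simp: prob_measure_on_def)

lemma mu_average:
  assumes "\<And>s. s \<in> carrier G \<Longrightarrow> 0 \<le> \<phi> s \<and> \<phi> s \<le> B"
  shows "(\<lambda>s. \<mu> s * \<phi> s) summable_on carrier G" "(\<Sum>\<^sub>\<infinity>s\<in>carrier G. \<mu> s * \<phi> s) \<le> B"
proof -
  have B: "((\<lambda>s. \<mu> s * B) has_sum B) (carrier G)"
    using has_sum_cmult_left[OF mu_has_sum, of B] by simp
  show *: "(\<lambda>s. \<mu> s * \<phi> s) summable_on carrier G"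
    by (rule summable_on_comparison_test[OF has_sum_imp_summable[OF B]])
       (auto simp: assms mu_nonneg intro!: mult_left_mono)
  show "(\<Sum>\<^sub>\<infinity>s\<in>carrier G. \<mu> s * \<phi> s) \<le> B"
    by (rule has_sum_mono[OF has_sum_infsum[OF *] B]) (auto simp: assms mu_nonneg intro!: mult_left_mono)
qed

lemma p_bounds: "g \<in> carrier G \<Longrightarrow> 0 \<le> p n g \<and> p n g \<le> 1"
proof (induction n arbitrary: g)
  case 0
  then show ?case by simp
next
  case (Suc n)
  have *: "0 \<le> p n (inv s \<otimes> g) \<and> p n (inv s \<otimes> g) \<le> 1" if "s \<in> carrier G" for s
    using Suc that by simp
  have "0 \<le> p (Suc n) g"
    using * mu_nonneg by (auto simp: convolution_def intro!: infsum_nonneg)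
  moreover have "p (Suc n) g \<le> 1"
    using mu_average(2)[of "\<lambda>s. p n (inv s \<otimes> g)", OF *] by (simp add: convolution_def)
  ultimately show ?case by simp
qed

lemmas p_nonneg = p_bounds[THEN conjunct1] and p_le_1 = p_bounds[THEN conjunct2]

text \<open>An \<open>infsum\<close> defaults to 0 when the family is not summable. Here summability
  comes from the bound of \<open>p n\<close> by 1, so the defining equation is a genuine
  sum.\<close>

lemma p_Suc_has_sum:
  assumes "g \<in> carrier G"
  shows "((\<lambda>s. \<mu> s * p n (inv s \<otimes> g)) has_sum p (Suc n) g) (carrier G)"
proof -
  have "(\<lambda>s. \<mu> s * p n (inv s \<otimes> g)) summable_on carrier G"
    using assms p_bounds by (intro mu_average(1)[where B = 1]) auto
  then show ?thesis
    by (simp add: convolution_def)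
qed

declare convolution_power.simps(2) [simp del]

text \<open>Among the ways in which \<open>n + m\<close> steps multiply to
  \<open>a \<otimes> b\<close> are those whose first \<open>n\<close> steps multiply to
  \<open>a\<close> and whose last \<open>m\<close> multiply to \<open>b\<close>.\<close>

lemma p_mult_le:
  "a \<in> carrier G \<Longrightarrow> b \<in> carrier G \<Longrightarrow> p n a * p m b \<le> p (n + m) (a \<otimes> b)"
proof (induction n arbitrary: a)
  case 0
  then show ?case
    by (auto simp: p_bounds)
next
  case (Suc n)
  have "p (Suc n) a * p m b \<le> p (Suc (n + m)) (a \<otimes> b)"
  proof (rule has_sum_mono)
    show "((\<lambda>s. \<mu> s * p n (inv s \<otimes> a) * p m b) has_sum p (Suc n) a * p m b) (carrier G)"
      using Suc.prems by (intro has_sum_cmult_left p_Suc_has_sum)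
    show "((\<lambda>s. \<mu> s * p (n + m) (inv s \<otimes> (a \<otimes> b))) has_sum p (Suc (n + m)) (a \<otimes> b)) (carrier G)"
      using Suc.prems by (intro p_Suc_has_sum) auto
    show "\<mu> s * p n (inv s \<otimes> a) * p m b \<le> \<mu> s * p (n + m) (inv s \<otimes> (a \<otimes> b))"
      if "s \<in> carrier G" for s
      using Suc.IH[of "inv s \<otimes> a"] Suc.prems that
      by (simp add: m_assoc mu_nonneg mult_left_mono mult.assoc)
  qed
  then show ?case by simp
qed

lemma p_one:
  assumes "g \<in> carrier G"
  shows "p 1 g = \<mu> g"
proof -
  have "((\<lambda>s. \<mu> s * p 0 (inv s \<otimes> g)) has_sum p 1 g) (carrier G)"
    using p_Suc_has_sum[OF assms, of 0] by simp
  moreover have "\<mu> s * p 0 (inv s \<otimes> g) = (if s = g then \<mu> s else 0)" if "s \<in> carrier G" for s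
    using that assms inv_solve_left[of \<one> s g] by auto
  ultimately have "((\<lambda>s. if s = g then \<mu> s else 0) has_sum p 1 g) (carrier G)"
    by (simp cong: has_sum_cong)
  moreover have "((\<lambda>s. if s = g then \<mu> s else 0) has_sum \<mu> g) (carrier G)"
    by (rule has_sum_finite_neutralI[of "{g}"]) (use assms in auto)
  ultimately show ?thesis
    by (rule has_sum_unique)
qed

text \<open>Non-degeneracy as an induction rule. The support generates as a semigroup, so no cases
  for the identity and for inverses arise.\<close>

lemma support_induct [consumes 1, case_names support mult]:
  assumes "g \<in> carrier G"
    and "\<And>s. s \<in> carrier G \<Longrightarrow> 0 < \<mu> s \<Longrightarrow> P s"
    and "\<And>a b. a \<in> carrier G \<Longrightarrow> b \<in> carrier G \<Longrightarrow> P a \<Longrightarrow> P b \<Longrightarrow> P (a \<otimes> b)"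
  shows "P g"
proof -
  have sg: "semigroup_generated G (measure_support G \<mu>) = carrier G"
    using nondeg by (simp add: nondegenerate_def)
  have "g \<in> semigroup_generated G (measure_support G \<mu>)"
    using assms(1) sg by simp
  then show ?thesis
    by induction (use assms(2,3) sg in \<open>auto simp: measure_support_def\<close>)
qed

text \<open>Irreducibility of the walk, obtained by multiplying positive probabilities through
  \<open>p_mult_le\<close>.\<close>

lemma p_pos_ex: "g \<in> carrier G \<Longrightarrow> \<exists>n. 0 < p n g"
proof (induction rule: support_induct)
  case (support s)
  then show ?case
    using p_one by metis
next
  case (mult a b)
  then obtain n m where "0 < p n a" "0 < p m b"
    by blast
  then have "0 < p (n + m) (a \<otimes> b)"
    using p_mult_le[OF mult(1,2), of n m] by (meson less_le_trans mult_pos_pos)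
  then show ?case ..
qed

text \<open>Left translation by \<open>inv s\<close> carries \<open>A\<close> injectively to another
  finite set, which is why the induction runs over all \<open>A\<close> at once.\<close>

lemma sum_p_le_1: "finite A \<Longrightarrow> A \<subseteq> carrier G \<Longrightarrow> (\<Sum>g\<in>A. p n g) \<le> 1"
proof (induction n arbitrary: A)
  case 0
  then show ?case
    by (simp add: sum.If_cases card_le_Suc0_iff_eq flip: One_nat_def)
next
  case (Suc n)
  have "((\<lambda>s. \<Sum>g\<in>A. \<mu> s * p n (inv s \<otimes> g)) has_sum (\<Sum>g\<in>A. p (Suc n) g)) (carrier G)"
    using Suc.prems by (intro has_sum_finite_sum p_Suc_has_sum) auto
  then show ?case
  proof (rule has_sum_mono[OF _ mu_has_sum])
    fix s assume s: "s \<in> carrier G"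
    have "inj_on (\<lambda>g. inv s \<otimes> g) A"
      using Suc.prems s by (auto simp: inj_on_def subset_iff)
    then have "(\<Sum>g\<in>A. p n (inv s \<otimes> g)) = (\<Sum>g\<in>(\<lambda>g. inv s \<otimes> g) ` A. p n g)"
      by (simp add: sum.reindex)
    also have "\<dots> \<le> 1"
      using Suc.prems s by (intro Suc.IH) auto
    finally show "(\<Sum>g\<in>A. \<mu> s * p n (inv s \<otimes> g)) \<le> \<mu> s"
      using mu_nonneg[OF s] mult_left_mono[of _ 1 "\<mu> s"] by (simp flip: sum_distrib_left)
  qed
qed

section \<open>Spectral radius and exponential decay of the return probabilities\<close>

lemma spectral_radius_le_1: "spectral_radius G \<mu> \<le> 1"
  unfolding spectral_radius_def
proof (rule Limsup_bounded, rule always_eventually, rule allI)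
  show "ereal (root n (p n \<one>)) \<le> 1" for n
    using p_le_1[of \<one> n] by (cases "n = 0") (auto simp: real_root_le_1_iff one_ereal_def)
qed

lemma exponential_decay_of_spectral_radius_less:
  assumes "spectral_radius G \<mu> < 1"
  obtains C r where "0 < r" "r < 1" "\<And>n. p n \<one> \<le> C * r ^ n"
proof -
  obtain r where r: "spectral_radius G \<mu> < ereal r" "r < 1"
    using ereal_dense2[OF assms] by (auto simp: one_ereal_def)
  \<comment> \<open>The maximum keeps the rate positive, so that \<open>1 / r'\<close> can be
    used.\<close>
  define r' where "r' = max r (1/2)"
  have r': "0 < r'" "r' < 1" "r \<le> r'"
    using r by (auto simp: r'_def)
  have "eventually (\<lambda>n. ereal (root n (p n \<one>)) < ereal r) sequentially"
    using r(1) unfolding spectral_radius_def by (rule Limsup_lessD)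
  then obtain N where N: "\<And>n. n \<ge> N \<Longrightarrow> root n (p n \<one>) < r"
    by (auto simp: eventually_sequentially)
  \<comment> \<open>The constant absorbs the terms with \<open>n \<le> N\<close>, where only
    \<open>p n \<one> \<le> 1\<close> is known. The threshold is \<open>Suc N\<close> so that
    \<open>n > 0\<close>, since \<open>root 0\<close> is constantly 0.\<close>
  have "p n \<one> \<le> (1 / r') ^ Suc N * r' ^ n" for n
  proof (cases "n \<ge> Suc N")
    case True
    then have "root n (p n \<one>) \<le> r'"
      using N[of n] r' by auto
    then have "root n (p n \<one>) ^ n \<le> r' ^ n"
      using p_nonneg[of \<one> n] by (intro power_mono real_root_ge_zero) auto
    then have "p n \<one> \<le> r' ^ n"
      using True p_nonneg[of \<one> n] by simp
    also have "\<dots> \<le> (1 / r') ^ Suc N * r' ^ n"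
      using mult_right_mono[of 1 "(1/r') ^ Suc N" "r' ^ n"] one_le_power[of "1/r'" "Suc N"] r' by simp
    finally show ?thesis .
  next
    case False
    then have "(1 / r') ^ n \<le> (1 / r') ^ Suc N"
      using r' by (intro power_increasing) auto
    then have "(1 / r') ^ n * r' ^ n \<le> (1 / r') ^ Suc N * r' ^ n"
      using r' by (intro mult_right_mono) auto
    moreover have "(1 / r') ^ n * r' ^ n = 1"
      using r' by (simp add: power_one_over)
    ultimately show ?thesis
      using p_le_1[of \<one> n] by simp
  qed
  then show thesis
    using that r' by blast
qed

lemma spectral_radius_less_1:
  assumes "0 \<le> r" "r < 1" "\<And>n. p n \<one> \<le> C * r ^ n"
  shows "spectral_radius G \<mu> < 1"
proof -
  \<comment> \<open>Positivity of the constant is what makes \<open>root n D\<close> tend to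
    1.\<close>
  define D where "D = max C 1"
  have D: "0 < D" "\<And>n. p n \<one> \<le> D * r ^ n"
    using assms mult_right_mono[of C D] by (auto simp: D_def intro!: order.trans[OF assms(3)])
  have "(\<lambda>n. root n D * r) \<longlonglongrightarrow> 1 * r"
    by (intro tendsto_intros LIMSEQ_root_const D)
  then have lim: "(\<lambda>n. ereal (root n D * r)) \<longlonglongrightarrow> ereal r"
    by simp
  have "spectral_radius G \<mu> \<le> limsup (\<lambda>n. ereal (root n D * r))"
    unfolding spectral_radius_def
  proof (rule Limsup_mono)
    show "\<forall>\<^sub>F n in sequentially. ereal (root n (p n \<one>)) \<le> ereal (root n D * r)"
      using eventually_gt_at_top[of 0]
    proof eventually_elim
      case (elim n)
      then have "root n (p n \<one>) \<le> root n (D * r ^ n)"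
        using D by simp
      then show ?case
        using elim assms(1) by (simp add: real_root_mult real_root_power_cancel)
    qed
  qed
  also have "\<dots> = ereal r"
    using lim by (intro lim_imp_Limsup) auto
  also have "\<dots> < 1"
    using assms(2) by (simp add: one_ereal_def)
  finally show ?thesis .
qed

section \<open>Exponential decay excludes centred measures in the presence of an invariant
  mean\<close>

lemma not_centred_of_exponential_decay:
  assumes M: "invariant_mean G M" and r: "0 < r" "r < 1" and decay: "\<And>n. p n \<one> \<le> C * r ^ n"
  shows "\<not> centred G S \<mu>"
proof
  assume centred: "centred G S \<mu>"
  have mean: "is_mean G M"
    using M by (simp add: invariant_mean_iff)
  \<comment> \<open>A value strictly between 1 and \<open>1 / r\<close>: the series for
    \<open>h\<close> converges because \<open>t * r < 1\<close>, and \<open>t > 1\<close> gives the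
    final contradiction.\<close>
  define t where "t = 1 / sqrt r"
  have t: "1 < t" "t * r = sqrt r"
    using r by (auto simp: t_def real_div_sqrt divide_simps)
  have tr: "0 < t * r" "t * r < 1"
    using r t by auto
  have summable: "summable (\<lambda>n. t ^ n * p n g)" if g: "g \<in> carrier G" for g
  proof -
    \<comment> \<open>Following \<open>g\<close> by \<open>k\<close> steps with product
      \<open>inv g\<close> leads back to the identity, so the decay at \<open>\<one>\<close> passes
      to \<open>g\<close> up to a constant.\<close>
    obtain k where k: "0 < p k (inv g)"
      using p_pos_ex g by blast
    show ?thesis
    proof (rule summable_comparison_test')
      show "summable (\<lambda>n. (C * r ^ k / p k (inv g)) * (t * r) ^ n)"
        using tr by (intro summable_mult summable_geometric) auto
      fix n
      have "p n g * p k (inv g) \<le> C * r ^ (n + k)"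
        using p_mult_le[of g "inv g" n k] g decay[of "n + k"] by simp
      then have "p n g \<le> C * r ^ k / p k (inv g) * r ^ n"
        using k by (simp add: field_simps power_add)
      then have "t ^ n * p n g \<le> t ^ n * (C * r ^ k / p k (inv g) * r ^ n)"
        using t by (intro mult_left_mono) auto
      then show "norm (t ^ n * p n g) \<le> C * r ^ k / p k (inv g) * (t * r) ^ n"
        using t(1) p_nonneg[OF g] by (simp add: power_mult_distrib mult_ac)
    qed
  qed
  define h where "h g = (\<Sum>n. t ^ n * p n g)" for g
  have nonneg: "0 \<le> t ^ n * p n g" if "g \<in> carrier G" for n g
    using t p_nonneg[OF that] by simp
  have h_pos: "0 < h g" if g: "g \<in> carrier G" for g
  proof -
    obtain k where "0 < p k g"
      using p_pos_ex g by blast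
    then have "0 < t ^ k * p k g"
      using t by simp
    then show ?thesis
      unfolding h_def using summable g nonneg by (intro suminf_pos2) auto
  qed
  have shift: "summable (\<lambda>n. t ^ (n + k) * p (n + k) g)"
      "(\<Sum>n. t ^ (n + k) * p (n + k) g) \<le> h g" if g: "g \<in> carrier G" for k g
    using summable[OF g] suminf_split_initial_segment[OF summable[OF g], of k]
      summable_ignore_initial_segment[OF summable[OF g], of k] sum_nonneg[of "{..<k}" "\<lambda>n. t ^ n * p n g"]
      nonneg[OF g] by (auto simp: h_def)
  \<comment> \<open>This is \<open>p_mult_le\<close> summed over \<open>n\<close>. Applied with
    \<open>a = s\<close> and with \<open>a = inv s\<close>, it bounds the quotient
    \<open>h (inv s \<otimes> g) / h g\<close> from above and below, uniformly in
    \<open>g\<close>.\<close>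
  have harnack: "t ^ k * p k a * h b \<le> h (a \<otimes> b)" if ab: "a \<in> carrier G" "b \<in> carrier G" for a b k
  proof -
    have "t ^ k * p k a * h b = (\<Sum>n. t ^ k * p k a * (t ^ n * p n b))"
      unfolding h_def using summable ab by (intro suminf_mult[symmetric]) auto
    also have "\<dots> \<le> (\<Sum>n. t ^ (n + k) * p (n + k) (a \<otimes> b))"
    proof (rule suminf_le)
      fix n
      have "t ^ (n + k) * (p k a * p n b) \<le> t ^ (n + k) * p (n + k) (a \<otimes> b)"
        using p_mult_le[OF ab, of k n] t by (intro mult_left_mono) (auto simp: add.commute)
      then show "t ^ k * p k a * (t ^ n * p n b) \<le> t ^ (n + k) * p (n + k) (a \<otimes> b)"
        by (simp add: power_add mult_ac)
    qed (use summable shift ab in \<open>auto intro!: summable_mult\<close>)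
    also have "\<dots> \<le> h (a \<otimes> b)"
      using shift ab by auto
    finally show ?thesis .
  qed
  \<comment> \<open>Convolution with \<open>\<mu>\<close> raises the index of \<open>p\<close> by
    one, which costs a factor \<open>t\<close> in the series and drops its term at 0.\<close>
  have superharmonic: "(\<Sum>s\<in>A. \<mu> s * h (inv s \<otimes> g)) \<le> h g / t"
    if A: "finite A" "A \<subseteq> carrier G" and g: "g \<in> carrier G" for A g
  proof -
    have "(\<Sum>s\<in>A. \<mu> s * h (inv s \<otimes> g)) = (\<Sum>s\<in>A. \<Sum>n. \<mu> s * (t ^ n * p n (inv s \<otimes> g)))"
      unfolding h_def using A g summable by (intro sum.cong suminf_mult[symmetric]) auto
    also have "\<dots> = (\<Sum>n. \<Sum>s\<in>A. \<mu> s * (t ^ n * p n (inv s \<otimes> g)))"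
      using A g summable by (intro suminf_sum[symmetric] summable_mult) auto
    also have "\<dots> \<le> (\<Sum>n. t ^ n * p (Suc n) g)"
    proof (rule suminf_le)
      fix n
      have "(\<Sum>s\<in>A. \<mu> s * p n (inv s \<otimes> g)) \<le> p (Suc n) g"
        using A g mu_nonneg p_nonneg
        by (intro finite_sum_le_has_sum[OF p_Suc_has_sum]) (auto simp: subset_iff)
      then have "t ^ n * (\<Sum>s\<in>A. \<mu> s * p n (inv s \<otimes> g)) \<le> t ^ n * p (Suc n) g"
        using t by (intro mult_left_mono) auto
      then show "(\<Sum>s\<in>A. \<mu> s * (t ^ n * p n (inv s \<otimes> g))) \<le> t ^ n * p (Suc n) g"
        by (simp add: sum_distrib_left mult_ac)
    next
      show "summable (\<lambda>n. \<Sum>s\<in>A. \<mu> s * (t ^ n * p n (inv s \<otimes> g)))"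
        using A g summable by (intro summable_sum summable_mult) auto
      show "summable (\<lambda>n. t ^ n * p (Suc n) g)"
        using summable_mult[OF shift(1)[OF g, of 1], of "1 / t"] t by simp
    qed
    also have "\<dots> = (\<Sum>n. t ^ (n + 1) * p (n + 1) g) / t"
      using suminf_divide[OF shift(1)[OF g, of 1], of t] t by simp
    also have "\<dots> \<le> h g / t"
      using shift(2)[OF g, of 1] t by (intro divide_right_mono) auto
    finally show ?thesis .
  qed
  define F where "F s g = ln (h (inv s \<otimes> g) / h g)" for s g
  have F_bounded: "F s \<in> bounded_functions G" if s: "s \<in> carrier G" for s
  proof -
    obtain k l where "0 < p k s" "0 < p l (inv s)"
      using p_pos_ex s by (meson inv_closed)
    then have K: "0 < t ^ k * p k s" (is "0 < ?K") and L: "0 < t ^ l * p l (inv s)" (is "0 < ?L")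
      using t by auto
    have "\<bar>F s g\<bar> \<le> \<bar>ln (1 / ?K)\<bar> + \<bar>ln ?L\<bar>" if g: "g \<in> carrier G" for g
    proof -
      have "?L \<le> h (inv s \<otimes> g) / h g"
        using harnack[of "inv s" g l] s g h_pos[OF g] by (simp add: field_simps)
      then have "ln ?L \<le> F s g"
        unfolding F_def using L by (intro ln_mono) auto
      moreover have "h (inv s \<otimes> g) / h g \<le> 1 / ?K"
        using harnack[of s "inv s \<otimes> g" k] s g h_pos[OF g] K
        by (simp add: field_simps m_assoc[symmetric])
      then have "F s g \<le> ln (1 / ?K)"
        unfolding F_def using h_pos s g K by (intro ln_mono) auto
      ultimately show ?thesis by linarith
    qed
    then show ?thesis
      by (auto simp: bounded_functions_iff)
  qed
  define \<phi> where "\<phi> s = M (F s)" for s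
  \<comment> \<open>The logarithmic quotients satisfy
    \<open>F (a \<otimes> b) g = F b (inv a \<otimes> g) + F a g\<close>, and invariance of
    \<open>M\<close> removes the translation by \<open>inv a\<close>.\<close>
  have "\<phi> \<in> hom G real_additive_group"
  proof (rule homI)
    fix a b assume ab: "a \<in> carrier G" "b \<in> carrier G"
    have shift_bounded: "(\<lambda>g. F b (inv a \<otimes> g)) \<in> bounded_functions G"
      using F_bounded[OF ab(2)] ab by (auto simp: bounded_functions_iff)
    have "\<phi> (a \<otimes> b) = M (\<lambda>g. F b (inv a \<otimes> g) + F a g)"
      unfolding \<phi>_def
    proof (rule mean_cong[OF mean])
      show "F (a \<otimes> b) g = F b (inv a \<otimes> g) + F a g" if g: "g \<in> carrier G" for g
        unfolding F_def using ab g h_pos[of "inv b \<otimes> (inv a \<otimes> g)"] h_pos[of "inv a \<otimes> g"] h_pos[of g]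
        by (simp add: ln_div inv_mult_group m_assoc)
    qed (use F_bounded ab shift_bounded one_closed in \<open>auto intro: bounded_functions_add\<close>)
    also have "\<dots> = M (\<lambda>g. F b (inv a \<otimes> g)) + M (F a)"
      using F_bounded ab shift_bounded by (intro mean_add[OF mean]) auto
    also have "M (\<lambda>g. F b (inv a \<otimes> g)) = M (F b)"
      using M F_bounded ab by (auto simp: invariant_mean_def)
    finally show "\<phi> (a \<otimes> b) = \<phi> a \<otimes>\<^bsub>real_additive_group\<^esub> \<phi> b"
      by (simp add: \<phi>_def real_additive_group_def)
  qed (simp add: real_additive_group_def)
  then have "((\<lambda>g. \<phi> g * \<mu> g) has_sum 0) (carrier G)"
    using centred by (auto simp: centred_def)
  \<comment> \<open>Adding \<open>\<mu>\<close> to both sides lets finite partial sums suffice, so \<open>M\<close> never meets an infinite sum.\<close>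
  from has_sum_add[OF this mu_has_sum] have "0 + 1 \<le> 1 / t"
  proof (rule has_sum_le_finite_sums)
    fix A assume A: "finite A" "A \<subseteq> carrier G"
    have "(\<Sum>s\<in>A. \<phi> s * \<mu> s) = M (\<lambda>g. \<Sum>s\<in>A. \<mu> s * F s g)"
      unfolding \<phi>_def using mean_sum[OF mean, of A F \<mu>] A F_bounded by (auto simp: mult.commute subset_iff)
    also have "\<dots> \<le> M (\<lambda>g. (1 / t - sum \<mu> A) * 1)"
    proof (rule mean_mono[OF mean])
      fix g assume g: "g \<in> carrier G"
      have "(\<Sum>s\<in>A. \<mu> s * F s g) \<le> (\<Sum>s\<in>A. \<mu> s * (h (inv s \<otimes> g) / h g - 1))"
        unfolding F_def using A g h_pos mu_nonneg
        by (intro sum_mono mult_left_mono ln_le_minus_one) (auto simp: subset_iff)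
      also have "\<dots> = (\<Sum>s\<in>A. \<mu> s * h (inv s \<otimes> g)) / h g - sum \<mu> A"
        by (simp add: algebra_simps sum_subtractf sum_divide_distrib)
      also have "\<dots> \<le> 1 / t - sum \<mu> A"
        using superharmonic[OF A g] h_pos[OF g] t by (simp add: field_simps)
      finally show "(\<Sum>s\<in>A. \<mu> s * F s g) \<le> (1 / t - sum \<mu> A) * 1" by simp
    next
      show "(\<lambda>g. \<Sum>s\<in>A. \<mu> s * F s g) \<in> bounded_functions G"
        using A F_bounded by (intro bounded_functions_sum) auto
      show "(\<lambda>g. (1 / t - sum \<mu> A) * 1) \<in> bounded_functions G"
        by (auto simp: bounded_functions_iff)
    qed (use one_closed in blast)
    also have "\<dots> = 1 / t - sum \<mu> A"
      using mean_const[OF mean] by simp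
    finally show "(\<Sum>s\<in>A. \<phi> s * \<mu> s + \<mu> s) \<le> 1 / t"
      by (simp add: sum.distrib)
  qed
  then show False
    using t by simp
qed

section \<open>Drift and the spectral radius\<close>

text \<open>A Chernoff bound: as a function of \<open>t\<close>, the sum of
  \<open>exp (t * \<phi> g) * \<mu> g\<close> has value 1 and slope \<open>m < 0\<close> at 0. An
  explicit quadratic remainder replaces differentiation. The weight \<open>w\<close> stands for the
  word length.\<close>

lemma negative_drift:
  assumes hom: "\<And>a b. a \<in> carrier G \<Longrightarrow> b \<in> carrier G \<Longrightarrow> \<phi> (a \<otimes> b) = \<phi> a + \<phi> b"
    and c: "0 < c" and L: "0 < L" and w: "\<And>g. g \<in> carrier G \<Longrightarrow> \<bar>\<phi> g\<bar> \<le> L * w g"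
    and drift: "((\<lambda>g. \<phi> g * \<mu> g) has_sum m) (carrier G)" "m < 0"
    and exp_moment: "(\<lambda>g. exp (c * w g) * \<mu> g) summable_on carrier G"
  shows "spectral_radius G \<mu> < 1"
proof -
  define E where "E = (\<Sum>\<^sub>\<infinity>g\<in>carrier G. exp (c * w g) * \<mu> g)"
  have E: "((\<lambda>g. exp (c * w g) * \<mu> g) has_sum E) (carrier G)"
    using exp_moment by (simp add: E_def)
  have w_nonneg: "0 \<le> w g" if "g \<in> carrier G" for g
    using w[OF that] L by (smt (verit) mult_pos_neg)
  have "1 \<le> E"
    using c w_nonneg mu_nonneg by (intro has_sum_mono[OF mu_has_sum E]) (simp add: mult_le_cancel_right1 order.strict_iff_not)
  \<comment> \<open>\<open>t\<^sup>2 * K\<close> bounds the sum of the quadratic remainders in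
    \<open>exp_le\<close> against \<open>\<mu>\<close>.\<close>
  define K where "K = 8 * L\<^sup>2 / c\<^sup>2 * E"
  have K: "0 < K"
    using c L \<open>1 \<le> E\<close> by (simp add: K_def)
  \<comment> \<open>The first entry gives \<open>\<bar>t * \<phi> g\<bar> \<le> c * w g / 2\<close>;
    the second gives \<open>m + t * K \<le> m / 2 < 0\<close>.\<close>
  define t where "t = min (c / (2 * L)) (- m / (2 * K))"
  have t: "0 < t" "t * L \<le> c / 2" "t * K \<le> - m / 2"
    using c L K drift(2) by (auto simp: t_def min_def field_simps)
  have exp_le: "exp (t * \<phi> g) \<le> 1 + t * \<phi> g + t\<^sup>2 * (8 * L\<^sup>2 / c\<^sup>2) * exp (c * w g)"
    if g: "g \<in> carrier G" for g
  proof -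
    define x where "x = t * \<phi> g"
    \<comment> \<open>Half of the available exponent: one factor \<open>exp y\<close> pays for
      \<open>exp z\<close> in the Taylor remainder, the other for the square, through
      \<open>y\<^sup>2 / 2 \<le> exp y\<close>.\<close>
    define y where "y = c * w g / 2"
    have y: "0 \<le> y"
      using c w_nonneg[OF g] by (simp add: y_def)
    have x: "\<bar>x\<bar> \<le> t * L * w g"
      using mult_left_mono[OF w[OF g], of t] t by (simp add: x_def abs_mult)
    also have "\<dots> \<le> y"
      using mult_right_mono[OF t(2) w_nonneg[OF g]] by (simp add: y_def)
    finally have xy: "\<bar>x\<bar> \<le> y" .
    obtain z where z: "\<bar>z\<bar> \<le> \<bar>x\<bar>" "exp x = (\<Sum>i<2. x ^ i / fact i) + exp z / fact 2 * x ^ 2"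
      using Maclaurin_exp_le[of x 2] by blast
    have "exp x = 1 + x + exp z / 2 * x\<^sup>2"
      using z(2) by (simp add: numeral_2_eq_2)
    also have "exp z / 2 * x\<^sup>2 \<le> exp y * (t * L * w g)\<^sup>2"
    proof (rule mult_mono)
      have "exp z \<le> exp y"
        using z(1) xy by simp
      then show "exp z / 2 \<le> exp y"
        using exp_gt_zero[of z] by linarith
      show "x\<^sup>2 \<le> (t * L * w g)\<^sup>2"
        using x by (metis abs_ge_zero power2_abs power_mono)
    qed auto
    also have "(t * L * w g)\<^sup>2 = t\<^sup>2 * (8 * L\<^sup>2 / c\<^sup>2) * (y\<^sup>2 / 2)"
      using c by (simp add: y_def power2_eq_square field_simps)
    also have "exp y * (t\<^sup>2 * (8 * L\<^sup>2 / c\<^sup>2) * (y\<^sup>2 / 2)) \<le> exp y * (t\<^sup>2 * (8 * L\<^sup>2 / c\<^sup>2) * exp y)"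
      using exp_lower_Taylor_quadratic[OF y] y by (intro mult_left_mono) auto
    also have "\<dots> = t\<^sup>2 * (8 * L\<^sup>2 / c\<^sup>2) * exp (c * w g)"
      using exp_add[of y y] by (simp add: y_def)
    finally show ?thesis by (simp add: x_def)
  qed
  have bound: "((\<lambda>g. \<mu> g + t * (\<phi> g * \<mu> g) + t\<^sup>2 * (8 * L\<^sup>2 / c\<^sup>2) * (exp (c * w g) * \<mu> g))
      has_sum (1 + t * m + t\<^sup>2 * (8 * L\<^sup>2 / c\<^sup>2) * E)) (carrier G)"
    by (intro has_sum_add has_sum_cmult_right mu_has_sum drift E)
  have le: "exp (t * \<phi> g) * \<mu> g
      \<le> \<mu> g + t * (\<phi> g * \<mu> g) + t\<^sup>2 * (8 * L\<^sup>2 / c\<^sup>2) * (exp (c * w g) * \<mu> g)"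
    if g: "g \<in> carrier G" for g
    using mult_right_mono[OF exp_le[OF g] mu_nonneg[OF g]] by (simp only: distrib_right mult.assoc mult_1)
  define \<rho> where "\<rho> = (\<Sum>\<^sub>\<infinity>g\<in>carrier G. exp (t * \<phi> g) * \<mu> g)"
  have \<rho>: "((\<lambda>g. exp (t * \<phi> g) * \<mu> g) has_sum \<rho>) (carrier G)"
    unfolding \<rho>_def using le mu_nonneg
    by (intro has_sum_infsum summable_on_comparison_test[OF has_sum_imp_summable[OF bound]]) auto
  have \<rho>_nonneg: "0 \<le> \<rho>"
    unfolding \<rho>_def using mu_nonneg by (intro infsum_nonneg) auto
  have "\<rho> \<le> 1 + t * m + t\<^sup>2 * (8 * L\<^sup>2 / c\<^sup>2) * E"
    using has_sum_mono[OF \<rho> bound] le by blast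
  also have "\<dots> = 1 + t * (m + t * K)"
    by (simp add: K_def power2_eq_square algebra_simps)
  also have "\<dots> < 1"
    using t drift(2) by (simp add: mult_less_0_iff)
  finally have "\<rho> < 1" .
  have "\<phi> \<one> = 0"
    using hom[of \<one> \<one>] by simp
  \<comment> \<open>The factor \<open>exp (t * \<phi> g)\<close> is multiplicative, so it
    distributes over the first step \<open>s\<close> and the rest \<open>inv s \<otimes> g\<close>,
    and each step contributes one factor \<open>\<rho>\<close>. At the identity the factor is
    1.\<close>
  have decay: "exp (t * \<phi> g) * p n g \<le> \<rho> ^ n" if "g \<in> carrier G" for n g
    using that
  proof (induction n arbitrary: g)
    case 0
    then show ?case
      using \<open>\<phi> \<one> = 0\<close> by simp
  next
    case (Suc n)
    show ?case
    proof (rule has_sum_mono)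
      show "((\<lambda>s. exp (t * \<phi> g) * (\<mu> s * p n (inv s \<otimes> g))) has_sum exp (t * \<phi> g) * p (Suc n) g) (carrier G)"
        using Suc.prems by (intro has_sum_cmult_right p_Suc_has_sum)
      show "((\<lambda>s. exp (t * \<phi> s) * \<mu> s * \<rho> ^ n) has_sum \<rho> ^ Suc n) (carrier G)"
        using has_sum_cmult_left[OF \<rho>, of "\<rho> ^ n"] by simp
      fix s assume s: "s \<in> carrier G"
      have "\<phi> g = \<phi> s + \<phi> (inv s \<otimes> g)"
        using hom[of s "inv s \<otimes> g"] s Suc.prems by (simp add: m_assoc[symmetric])
      then have "exp (t * \<phi> g) * (\<mu> s * p n (inv s \<otimes> g))
          = exp (t * \<phi> s) * \<mu> s * (exp (t * \<phi> (inv s \<otimes> g)) * p n (inv s \<otimes> g))"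
        by (simp add: distrib_left exp_add)
      also have "\<dots> \<le> exp (t * \<phi> s) * \<mu> s * \<rho> ^ n"
        using Suc s mu_nonneg[OF s] by (intro mult_left_mono) auto
      finally show "exp (t * \<phi> g) * (\<mu> s * p n (inv s \<otimes> g)) \<le> exp (t * \<phi> s) * \<mu> s * \<rho> ^ n" .
    qed
  qed
  show ?thesis
    using decay[of \<one>] \<open>\<phi> \<one> = 0\<close> by (intro spectral_radius_less_1[OF \<rho>_nonneg \<open>\<rho> < 1\<close>, of 1]) auto
qed

text \<open>A homomorphism grows at most linearly in the word length, so its drift exists. Since
  \<open>negative_drift\<close> applies to both \<open>\<phi>\<close> and its negative, the drift
  can have neither sign.\<close>

lemma centred_of_spectral_radius:
  assumes S: "finite_generating_set G S" and c: "0 < c"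
    and exp_moment: "finite_exponential_moment G S \<mu> c" and radius: "spectral_radius G \<mu> = 1"
  shows "centred G S \<mu>"
  unfolding centred_def
proof (intro conjI ballI)
  let ?w = "\<lambda>g. real (word_length G S g)"
  have "(\<lambda>g. exp (c * ?w g) * \<mu> g) summable_on carrier G"
    using exp_moment by (simp add: finite_exponential_moment_def)
  then have "(\<lambda>g. (1 / c) * (exp (c * ?w g) * \<mu> g)) summable_on carrier G"
    by (rule summable_on_cmult_right)
  then have first: "(\<lambda>g. ?w g * \<mu> g) summable_on carrier G"
  proof (rule summable_on_comparison_test)
    fix g assume g: "g \<in> carrier G"
    have "c * ?w g \<le> exp (c * ?w g)"
      using exp_ge_add_one_self[of "c * ?w g"] by linarith
    then have "?w g \<le> (1 / c) * exp (c * ?w g)"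
      using c by (simp add: field_simps)
    then show "?w g * \<mu> g \<le> (1 / c) * (exp (c * ?w g) * \<mu> g)"
      using mult_right_mono mu_nonneg[OF g] by (metis mult.assoc)
  qed (simp add: mu_nonneg)
  then show "finite_first_moment G S \<mu>"
    by (simp add: finite_first_moment_def)
  fix \<phi> assume "\<phi> \<in> hom G real_additive_group"
  then have hom: "\<phi> (a \<otimes> b) = \<phi> a + \<phi> b" if "a \<in> carrier G" "b \<in> carrier G" for a b
    using that by (auto simp: hom_def real_additive_group_def)
  \<comment> \<open>The summand 1 keeps \<open>L\<close> positive even if \<open>\<phi>\<close>
    vanishes on \<open>S\<close>.\<close>
  define L where "L = 1 + (\<Sum>s\<in>S. \<bar>\<phi> s\<bar>)"
  have "0 < L"
    by (simp add: L_def add_pos_nonneg sum_nonneg)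
  have S': "finite S" "S \<subseteq> carrier G"
    using S by (auto simp: finite_generating_set_def)
  have letter: "\<bar>\<phi> s\<bar> \<le> L" if s: "s \<in> S \<union> m_inv G ` S" for s
  proof -
    have "\<bar>\<phi> s\<bar> \<le> L" if "s \<in> S" for s
      using member_le_sum[OF that, of "\<lambda>s. \<bar>\<phi> s\<bar>"] S' by (simp add: L_def)
    moreover have "\<phi> (inv s) = - \<phi> s" if "s \<in> carrier G" for s
      using hom[of s "inv s"] hom[of \<one> \<one>] that by simp
    ultimately show ?thesis
      using s S' by (auto simp: subset_iff)
  qed
  have word: "foldr (\<otimes>) ws \<one> \<in> carrier G \<and> \<bar>\<phi> (foldr (\<otimes>) ws \<one>)\<bar> \<le> L * length ws"
    if "set ws \<subseteq> S \<union> m_inv G ` S" for ws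
    using that
  proof (induction ws)
    case Nil
    then show ?case
      using hom[of \<one> \<one>] by simp
  next
    case (Cons s ws)
    have s: "s \<in> carrier G" "\<bar>\<phi> s\<bar> \<le> L"
      using Cons.prems S' letter by auto
    then show ?case
      using Cons hom[of s "foldr (\<otimes>) ws \<one>"] by (auto simp: distrib_left)
  qed
  have w: "\<bar>\<phi> g\<bar> \<le> L * ?w g" if "g \<in> carrier G" for g
    using word word_length_attained[OF S that] by metis
  have "(\<lambda>g. L * (?w g * \<mu> g)) summable_on carrier G"
    using first by (rule summable_on_cmult_right)
  then have "(\<lambda>g. \<phi> g * \<mu> g) abs_summable_on carrier G"
  proof (rule summable_on_comparison_test)
    fix g assume "g \<in> carrier G"
    then show "norm (\<phi> g * \<mu> g) \<le> L * (?w g * \<mu> g)"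
      using mult_right_mono[OF w mu_nonneg] by (simp add: abs_mult mu_nonneg mult.assoc)
  qed simp
  then have "(\<lambda>g. \<phi> g * \<mu> g) summable_on carrier G"
    by (rule abs_summable_summable)
  then obtain m where m: "((\<lambda>g. \<phi> g * \<mu> g) has_sum m) (carrier G)"
    by (auto simp: summable_on_def)
  have "\<not> m < 0"
    using negative_drift[of \<phi> c L ?w m] hom c \<open>0 < L\<close> w m exp_moment radius
    by (auto simp: finite_exponential_moment_def)
  moreover have "\<not> - m < 0"
    using negative_drift[of "\<lambda>g. - \<phi> g" c L ?w "- m"] hom c \<open>0 < L\<close> w has_sum_uminusI[OF m] exp_moment radius
    by (auto simp: finite_exponential_moment_def)
  ultimately show "((\<lambda>g. \<phi> g * \<mu> g) has_sum 0) (carrier G)"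
    using m by simp
qed

section \<open>From spectral radius one to amenability\<close>

text \<open>The pairing controls only the \<open>\<mu>\<close>-average of the defects
  \<open>1 - overlap\<close>. These are non-negative, so each one weighted by \<open>\<mu> s\<close>
  is at most the average.\<close>

lemma almost_invariant_functions:
  assumes radius: "spectral_radius G \<mu> = 1" and \<epsilon>: "0 < \<epsilon>"
  obtains f where "\<And>g. g \<in> carrier G \<Longrightarrow> 0 \<le> f g"
    and "((\<lambda>g. (f g)\<^sup>2) has_sum 1) (carrier G)"
    and "\<And>s. s \<in> carrier G \<Longrightarrow> \<mu> s * (1 - (\<Sum>\<^sub>\<infinity>g\<in>carrier G. f g * f (inv s \<otimes> g))) \<le> \<epsilon>"
proof -
  \<comment> \<open>The estimates below end with the error \<open>2 / (k + 1)\<close>.\<close>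
  obtain k :: nat where k: "2 / \<epsilon> < real k"
    using reals_Archimedean2 by blast
  then have k0: "0 < real k"
    using \<epsilon> by (smt (verit) divide_pos_pos)
  have k\<epsilon>: "2 / (real k + 1) \<le> \<epsilon>"
    using k k0 \<epsilon> by (simp add: field_simps)
  \<comment> \<open>With \<open>\<parallel>u\<parallel> > k\<close>, the source term at the identity
    costs a fraction \<open>1 / k\<close> of \<open>\<parallel>u\<parallel>\<^sup>2\<close>. This
    \<open>t\<close> turns the remaining \<open>1 - 1 / k\<close> into
    \<open>W / D \<ge> (k - 1) / (k + 1)\<close>.\<close>
  define t where "t = 1 + 1 / real k"
  have t: "1 < t" "t = (real k + 1) / real k"
    using k0 by (auto simp: t_def field_simps)
  \<comment> \<open>If all these terms were at most \<open>k\<close>, the return probabilities would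
    decay at rate \<open>1 / t < 1\<close>.\<close>
  have "\<exists>N. real k < t ^ N * p N \<one>"
  proof (rule ccontr)
    assume "\<not> ?thesis"
    then have "p n \<one> \<le> real k * (1 / t) ^ n" for n
      using t(1) by (simp add: not_less field_simps power_one_over)
    then have "spectral_radius G \<mu> < 1"
      using t by (intro spectral_radius_less_1[of "1 / t"]) auto
    then show False
      using radius by simp
  qed
  then obtain N where N: "real k < t ^ N * p N \<one>"
    by blast
  define u where "u g = (\<Sum>n\<le>N. t ^ n * p n g)" for g
  \<comment> \<open>This is \<open>\<mu> * u\<close>, as \<open>v_has_sum\<close> shows. Its top
    term exceeds the range of \<open>u\<close>, whence only an inequality in
    \<open>u_le\<close>.\<close>
  define v where "v g = (\<Sum>n\<le>N. t ^ n * p (Suc n) g)" for g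
  have u_nonneg: "0 \<le> u g" if "g \<in> carrier G" for g
    using t p_nonneg[OF that] by (auto simp: u_def intro!: sum_nonneg)
  have u_one: "real k < u \<one>"
    using N member_le_sum[of N "{..N}" "\<lambda>n. t ^ n * p n \<one>"] t p_nonneg[of \<one>] by (simp add: u_def)
  have u_le: "u g \<le> p 0 g + t * v g" if g: "g \<in> carrier G" for g
  proof -
    have "u g = p 0 g + (\<Sum>n<N. t ^ Suc n * p (Suc n) g)"
      by (simp only: u_def sum.atMost_shift power_0 mult_1)
    also have "(\<Sum>n<N. t ^ Suc n * p (Suc n) g) \<le> (\<Sum>n\<le>N. t ^ Suc n * p (Suc n) g)"
      using t p_nonneg[OF g] by (intro sum_mono2) auto
    also have "\<dots> = t * v g"
      by (simp add: v_def sum_distrib_left mult.assoc)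
    finally show ?thesis by simp
  qed
  have v_has_sum: "((\<lambda>s. \<mu> s * u (inv s \<otimes> g)) has_sum v g) (carrier G)" if g: "g \<in> carrier G" for g
  proof -
    have "((\<lambda>s. \<Sum>n\<le>N. t ^ n * (\<mu> s * p n (inv s \<otimes> g))) has_sum v g) (carrier G)"
      unfolding v_def using g by (intro has_sum_finite_sum has_sum_cmult_right p_Suc_has_sum) auto
    then show ?thesis
      by (simp add: u_def sum_distrib_left mult_ac)
  qed
  define T where "T = (\<Sum>n\<le>N. t ^ n)"
  have sum_u: "sum u A \<le> T" if A: "finite A" "A \<subseteq> carrier G" for A
  proof -
    have "sum u A = (\<Sum>n\<le>N. t ^ n * (\<Sum>g\<in>A. p n g))"
      unfolding u_def by (subst sum.swap) (simp add: sum_distrib_left)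
    also have "\<dots> \<le> (\<Sum>n\<le>N. t ^ n * 1)"
      using t sum_p_le_1[OF A] by (intro sum_mono mult_left_mono) auto
    finally show ?thesis by (simp add: T_def)
  qed
  have u_bound: "u g \<le> T" if "g \<in> carrier G" for g
    using sum_u[of "{g}"] that by simp
  have "0 \<le> T"
    using t by (auto simp: T_def intro!: sum_nonneg)
  \<comment> \<open>The truncation makes \<open>u\<close> bounded and summable, hence square
    summable.\<close>
  have u2_summable: "(\<lambda>g. (u g)\<^sup>2) summable_on carrier G"
  proof (rule summable_on_of_finite_sums_le)
    fix A assume A: "finite A" "A \<subseteq> carrier G"
    have "(\<Sum>g\<in>A. (u g)\<^sup>2) \<le> (\<Sum>g\<in>A. T * u g)"
      unfolding power2_eq_square using A u_bound u_nonneg by (intro sum_mono mult_right_mono) auto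
    also have "\<dots> \<le> T * T"
      using mult_left_mono[OF sum_u[OF A] \<open>0 \<le> T\<close>] by (simp add: sum_distrib_left)
    finally show "(\<Sum>g\<in>A. (u g)\<^sup>2) \<le> T * T" .
  qed simp
  define D where "D = (\<Sum>\<^sub>\<infinity>g\<in>carrier G. (u g)\<^sup>2)"
  have D: "((\<lambda>g. (u g)\<^sup>2) has_sum D) (carrier G)"
    using u2_summable by (simp add: D_def)
  have D_shift: "((\<lambda>g. (u (inv s \<otimes> g))\<^sup>2) has_sum D) (carrier G)" if "s \<in> carrier G" for s
    using D has_sum_reindex_bij_betw[OF bij_betw_translation[OF inv_closed[OF that]], of "\<lambda>g. (u g)\<^sup>2" D]
    by simp
  have u_one_le: "u \<one> \<le> sqrt D"
    using finite_sum_le_has_sum[OF D, of "{\<one>}"] u_nonneg[of \<one>] by (simp add: real_le_rsqrt)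
  have "real k < sqrt D"
    using u_one u_one_le by linarith
  moreover from this have "0 < sqrt D"
    using k0 by linarith
  ultimately have D_pos: "0 < D" "real k < sqrt D"
    by auto
  define c where "c s = (\<Sum>\<^sub>\<infinity>g\<in>carrier G. u g * u (inv s \<otimes> g))" for s
  have c: "((\<lambda>g. u g * u (inv s \<otimes> g)) has_sum c s) (carrier G)" "0 \<le> c s" "c s \<le> D"
    if s: "s \<in> carrier G" for s
  proof -
    \<comment> \<open>Translation preserves the norm, so the inequality between arithmetic and
      geometric means serves as Cauchy-Schwarz.\<close>
    have bound: "((\<lambda>g. ((u g)\<^sup>2 + (u (inv s \<otimes> g))\<^sup>2) / 2) has_sum (D + D) / 2) (carrier G)"
      using D D_shift[OF s] by (intro has_sum_divide_const has_sum_add)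
    have le: "u g * u (inv s \<otimes> g) \<le> ((u g)\<^sup>2 + (u (inv s \<otimes> g))\<^sup>2) / 2" for g
      using sum_squares_bound[of "u g" "u (inv s \<otimes> g)"] by simp
    show *: "((\<lambda>g. u g * u (inv s \<otimes> g)) has_sum c s) (carrier G)"
      unfolding c_def using s u_nonneg le
      by (intro has_sum_infsum summable_on_comparison_test[OF has_sum_imp_summable[OF bound]]) auto
    show "0 \<le> c s"
      using s u_nonneg by (auto simp: c_def intro!: infsum_nonneg)
    show "c s \<le> D"
      using has_sum_mono[OF * bound le] by simp
  qed
  define W where "W = (\<Sum>\<^sub>\<infinity>s\<in>carrier G. \<mu> s * c s)"
  have W: "((\<lambda>s. \<mu> s * c s) has_sum W) (carrier G)"
    unfolding W_def using c by (intro has_sum_infsum mu_average(1)[where B = D]) auto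
  \<comment> \<open>Pairing \<open>u_le\<close> with \<open>u\<close>. Working with finite
    \<open>A\<close> restricts the exchange of sums to a finite sum of infinite ones.\<close>
  have "D \<le> u \<one> + t * W"
  proof (rule has_sum_le_finite_sums[OF D])
    fix A assume A: "finite A" "A \<subseteq> carrier G"
    have "(\<Sum>g\<in>A. (u g)\<^sup>2) \<le> (\<Sum>g\<in>A. u g * (p 0 g + t * v g))"
      unfolding power2_eq_square using A u_nonneg by (intro sum_mono mult_left_mono u_le) auto
    also have "\<dots> = (\<Sum>g\<in>A. u g * p 0 g) + t * (\<Sum>g\<in>A. u g * v g)"
      by (simp add: distrib_left sum.distrib sum_distrib_left mult_ac)
    also have "(\<Sum>g\<in>A. u g * p 0 g) \<le> u \<one>"
      using A u_nonneg[of \<one>] by (simp add: if_distrib sum.delta cong: if_cong)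
    also have "(\<Sum>g\<in>A. u g * v g) \<le> W"
    proof (rule has_sum_mono[OF _ W])
      show "((\<lambda>s. \<Sum>g\<in>A. u g * (\<mu> s * u (inv s \<otimes> g))) has_sum (\<Sum>g\<in>A. u g * v g)) (carrier G)"
        using A by (intro has_sum_finite_sum has_sum_cmult_right v_has_sum) auto
      fix s assume s: "s \<in> carrier G"
      have "(\<Sum>g\<in>A. u g * (\<mu> s * u (inv s \<otimes> g))) = \<mu> s * (\<Sum>g\<in>A. u g * u (inv s \<otimes> g))"
        by (simp add: sum_distrib_left mult_ac)
      also have "\<dots> \<le> \<mu> s * c s"
        using A s u_nonneg mu_nonneg[OF s]
        by (intro mult_left_mono finite_sum_le_has_sum[OF c(1)]) auto
      finally show "(\<Sum>g\<in>A. u g * (\<mu> s * u (inv s \<otimes> g))) \<le> \<mu> s * c s" .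
    qed
    finally show "(\<Sum>g\<in>A. (u g)\<^sup>2) \<le> u \<one> + t * W"
      using t(1) by (simp add: mult_left_mono)
  qed
  moreover have "sqrt D \<le> D / real k"
    using D_pos k0 mult_right_mono[of "real k" "sqrt D" "sqrt D"] by (simp add: field_simps)
  ultimately have "D - D / real k \<le> t * W"
    using u_one_le by linarith
  then have "(D - D / real k) * real k \<le> t * W * real k"
    using k0 by (intro mult_right_mono) auto
  moreover have "(D - D / real k) * real k = D * (real k - 1)"
    using k0 by (simp add: field_simps)
  moreover have "t * W * real k = (real k + 1) * W"
    using k0 by (simp add: t(2))
  ultimately have "D * (real k - 1) \<le> (real k + 1) * W"
    by simp
  then have DW: "D - W \<le> D * (2 / (real k + 1))"
    using k0 by (simp add: field_simps)
  define f where "f g = u g / sqrt D" for g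
  show thesis
  proof (rule that)
    show "0 \<le> f g" if "g \<in> carrier G" for g
      using u_nonneg[OF that] D_pos by (simp add: f_def)
    show "((\<lambda>g. (f g)\<^sup>2) has_sum 1) (carrier G)"
      using has_sum_divide_const[OF D, of D] D_pos by (simp add: f_def power_divide)
    fix s assume s: "s \<in> carrier G"
    have "((\<lambda>g. f g * f (inv s \<otimes> g)) has_sum c s / D) (carrier G)"
      using has_sum_divide_const[OF c(1)[OF s], of D] D_pos by (simp add: f_def)
    then have fc: "(\<Sum>\<^sub>\<infinity>g\<in>carrier G. f g * f (inv s \<otimes> g)) = c s / D"
      by (rule infsumI)
    \<comment> \<open>All terms are non-negative because \<open>c s \<le> D\<close>, so a single one
      is bounded by the total \<open>D - W\<close>.\<close>
    have "((\<lambda>s. \<mu> s * D - \<mu> s * c s) has_sum 1 * D - W) (carrier G)"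
      using has_sum_add[OF has_sum_cmult_left[OF mu_has_sum, of D] has_sum_uminusI[OF W]] by simp
    then have "sum (\<lambda>s. \<mu> s * D - \<mu> s * c s) {s} \<le> 1 * D - W"
      using s c mu_nonneg by (intro finite_sum_le_has_sum) (auto intro!: mult_left_mono)
    then have "\<mu> s * (D - c s) \<le> D * (2 / (real k + 1))"
      using DW by (simp add: right_diff_distrib)
    then have "\<mu> s * (1 - c s / D) \<le> 2 / (real k + 1)"
      using D_pos k0 by (simp add: field_simps)
    then show "\<mu> s * (1 - (\<Sum>\<^sub>\<infinity>g\<in>carrier G. f g * f (inv s \<otimes> g))) \<le> \<epsilon>"
      unfolding fc using k\<epsilon> by linarith
  qed
qed

text \<open>With \<open>a = f g\<close> and \<open>b = f (inv s \<otimes> g)\<close>, the difference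
  of squares factors as \<open>(b - a) * (b + a)\<close>. A weighted inequality of means with
  parameter \<open>\<eta>\<close> splits the product, and the squares of \<open>b - a\<close> sum to
  twice the defect. The total is \<open>2 * \<eta> + (1 - c) / \<eta>\<close>.\<close>

lemma almost_invariant_squares:
  fixes f :: "'a \<Rightarrow> real"
  assumes f: "\<And>g. g \<in> carrier G \<Longrightarrow> 0 \<le> f g" "((\<lambda>g. (f g)\<^sup>2) has_sum 1) (carrier G)"
    and s: "s \<in> carrier G" and \<eta>: "0 < \<eta>"
    and overlap: "1 - (\<Sum>\<^sub>\<infinity>g\<in>carrier G. f g * f (inv s \<otimes> g)) \<le> \<eta>\<^sup>2"
  shows "(\<lambda>g. \<bar>(f (inv s \<otimes> g))\<^sup>2 - (f g)\<^sup>2\<bar>) summable_on carrier G"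
    and "(\<Sum>\<^sub>\<infinity>g\<in>carrier G. \<bar>(f (inv s \<otimes> g))\<^sup>2 - (f g)\<^sup>2\<bar>) \<le> 3 * \<eta>"
proof -
  have shift: "((\<lambda>g. (f (inv s \<otimes> g))\<^sup>2) has_sum 1) (carrier G)"
    using f(2) has_sum_reindex_bij_betw[OF bij_betw_translation[OF inv_closed[OF s]], of "\<lambda>g. (f g)\<^sup>2" 1]
    by simp
  define c where "c = (\<Sum>\<^sub>\<infinity>g\<in>carrier G. f g * f (inv s \<otimes> g))"
  have add: "((\<lambda>g. (f g)\<^sup>2 + (f (inv s \<otimes> g))\<^sup>2) has_sum 1 + 1) (carrier G)"
    by (intro has_sum_add f shift)
  have "(\<lambda>g. f g * f (inv s \<otimes> g)) summable_on carrier G"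
  proof (rule summable_on_comparison_test[OF has_sum_imp_summable[OF add]])
    fix g assume g: "g \<in> carrier G"
    show "0 \<le> f g * f (inv s \<otimes> g)"
      using g s f by simp
    then show "f g * f (inv s \<otimes> g) \<le> (f g)\<^sup>2 + (f (inv s \<otimes> g))\<^sup>2"
      using sum_squares_bound[of "f g" "f (inv s \<otimes> g)"] by linarith
  qed
  then have c: "((\<lambda>g. f g * f (inv s \<otimes> g)) has_sum c) (carrier G)"
    by (simp add: c_def)
  have bound: "((\<lambda>g. \<eta> * ((f g)\<^sup>2 + (f (inv s \<otimes> g))\<^sup>2)
        + (1 / (2 * \<eta>)) * ((f g)\<^sup>2 + (f (inv s \<otimes> g))\<^sup>2 + (- 2) * (f g * f (inv s \<otimes> g))))
      has_sum (\<eta> * (1 + 1) + (1 / (2 * \<eta>)) * (1 + 1 + (- 2) * c))) (carrier G)"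
    by (intro has_sum_add has_sum_cmult_right f shift c)
  have le: "\<bar>(f (inv s \<otimes> g))\<^sup>2 - (f g)\<^sup>2\<bar> \<le> \<eta> * ((f g)\<^sup>2 + (f (inv s \<otimes> g))\<^sup>2)
      + (1 / (2 * \<eta>)) * ((f g)\<^sup>2 + (f (inv s \<otimes> g))\<^sup>2 + (- 2) * (f g * f (inv s \<otimes> g)))" for g
  proof -
    define a b where "a = f g" and "b = f (inv s \<otimes> g)"
    have "\<bar>b\<^sup>2 - a\<^sup>2\<bar> = \<bar>b - a\<bar> * \<bar>a + b\<bar>"
      by (simp add: power2_eq_square algebra_simps flip: abs_mult)
    moreover have "2 * \<eta> * (\<bar>b - a\<bar> * \<bar>a + b\<bar>) \<le> (b - a)\<^sup>2 + \<eta>\<^sup>2 * (a + b)\<^sup>2"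
      using sum_squares_bound[of "\<bar>b - a\<bar>" "\<eta> * \<bar>a + b\<bar>"] by (simp add: power_mult_distrib mult_ac)
    moreover have "(a + b)\<^sup>2 \<le> 2 * (a\<^sup>2 + b\<^sup>2)"
      using sum_squares_bound[of a b] by (simp add: power2_sum)
    then have "\<eta>\<^sup>2 * (a + b)\<^sup>2 \<le> \<eta>\<^sup>2 * (2 * (a\<^sup>2 + b\<^sup>2))"
      by (intro mult_left_mono) auto
    ultimately have "2 * \<eta> * \<bar>b\<^sup>2 - a\<^sup>2\<bar> \<le> (b - a)\<^sup>2 + \<eta>\<^sup>2 * (2 * (a\<^sup>2 + b\<^sup>2))"
      by simp
    then have "\<bar>b\<^sup>2 - a\<^sup>2\<bar> \<le> ((b - a)\<^sup>2 + \<eta>\<^sup>2 * (2 * (a\<^sup>2 + b\<^sup>2))) / (2 * \<eta>)"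
      using \<eta> by (simp add: field_simps)
    also have "\<dots> = \<eta> * (a\<^sup>2 + b\<^sup>2) + (1 / (2 * \<eta>)) * (a\<^sup>2 + b\<^sup>2 + (- 2) * (a * b))"
      using \<eta> by (simp add: power2_eq_square field_simps)
    finally show ?thesis by (simp add: a_def b_def)
  qed
  show *: "(\<lambda>g. \<bar>(f (inv s \<otimes> g))\<^sup>2 - (f g)\<^sup>2\<bar>) summable_on carrier G"
    using le by (intro summable_on_comparison_test[OF has_sum_imp_summable[OF bound]]) auto
  have "(\<Sum>\<^sub>\<infinity>g\<in>carrier G. \<bar>(f (inv s \<otimes> g))\<^sup>2 - (f g)\<^sup>2\<bar>)
      \<le> \<eta> * (1 + 1) + (1 / (2 * \<eta>)) * (1 + 1 + (- 2) * c)"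
    using has_sum_mono[OF has_sum_infsum[OF *] bound le] .
  also have "\<dots> = 2 * \<eta> + (1 - c) / \<eta>"
    using \<eta> by (simp add: field_simps)
  also have "\<dots> \<le> 2 * \<eta> + \<eta>\<^sup>2 / \<eta>"
    using overlap \<eta> by (intro add_left_mono divide_right_mono) (auto simp: c_def)
  finally show "(\<Sum>\<^sub>\<infinity>g\<in>carrier G. \<bar>(f (inv s \<otimes> g))\<^sup>2 - (f g)\<^sup>2\<bar>) \<le> 3 * \<eta>"
    using \<eta> by (simp add: power2_eq_square)
qed

text \<open>Squares of functions of norm one are weights of total mass one. The cluster mean is
  invariant under the support, and semigroup generation extends this to the whole group.\<close>

lemma amenable_of_spectral_radius:
  assumes radius: "spectral_radius G \<mu> = 1"
  shows "amenable G"
proof -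
  define P where "P k f \<longleftrightarrow> (\<forall>g\<in>carrier G. 0 \<le> f g) \<and> ((\<lambda>g. (f g)\<^sup>2) has_sum 1) (carrier G) \<and>
      (\<forall>s\<in>carrier G. \<mu> s * (1 - (\<Sum>\<^sub>\<infinity>g\<in>carrier G. f g * f (inv s \<otimes> g))) \<le> inverse (real (Suc k)))"
    for k f
  have "\<exists>f. P k f" for k
  proof -
    have "0 < inverse (real (Suc k))"
      by simp
    then show ?thesis
    proof (rule almost_invariant_functions[OF radius])
      fix f :: "'a \<Rightarrow> real"
      assume "\<And>g. g \<in> carrier G \<Longrightarrow> 0 \<le> f g" "((\<lambda>g. (f g)\<^sup>2) has_sum 1) (carrier G)"
        "\<And>s. s \<in> carrier G \<Longrightarrow>
          \<mu> s * (1 - (\<Sum>\<^sub>\<infinity>g\<in>carrier G. f g * f (inv s \<otimes> g))) \<le> inverse (real (Suc k))"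
      then have "P k f"
        by (simp add: P_def)
      then show ?thesis
        by blast
    qed
  qed
  then obtain f where "\<And>k. P k (f k)"
    by metis
  then have f: "\<And>k g. g \<in> carrier G \<Longrightarrow> 0 \<le> f k g"
      "\<And>k. ((\<lambda>g. (f k g)\<^sup>2) has_sum 1) (carrier G)"
      "\<And>k s. s \<in> carrier G \<Longrightarrow>
        \<mu> s * (1 - (\<Sum>\<^sub>\<infinity>g\<in>carrier G. f k g * f k (inv s \<otimes> g))) \<le> inverse (real (Suc k))"
    unfolding P_def by blast+
  obtain M where mean: "is_mean G M"
    and M: "\<And>s F. s \<in> measure_support G \<mu> \<Longrightarrow> F \<in> bounded_functions G \<Longrightarrow> M (\<lambda>x. F (s \<otimes> x)) = M F"
  proof (rule mean_of_almost_invariant_weights[where w = "\<lambda>k g. (f k g)\<^sup>2" and A = "measure_support G \<mu>"])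
    fix s assume "s \<in> measure_support G \<mu>"
    then have s: "s \<in> carrier G" "0 < \<mu> s"
      by (auto simp: measure_support_def)
    show "\<exists>d. d \<longlonglongrightarrow> 0 \<and> (\<forall>k. (\<lambda>g. \<bar>(f k (inv s \<otimes> g))\<^sup>2 - (f k g)\<^sup>2\<bar>) summable_on carrier G \<and>
        (\<Sum>\<^sub>\<infinity>g\<in>carrier G. \<bar>(f k (inv s \<otimes> g))\<^sup>2 - (f k g)\<^sup>2\<bar>) \<le> d k)"
    proof (intro exI conjI allI)
      \<comment> \<open>Division by \<open>\<mu> s\<close> makes the rate depend on
        \<open>s\<close>. This is harmless, since convergence is required for each \<open>s\<close>
        in the support separately.\<close>
      let ?\<eta> = "\<lambda>k. sqrt (inverse (real (Suc k)) / \<mu> s)"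
      have "(\<lambda>k. 3 * ?\<eta> k) \<longlonglongrightarrow> 3 * sqrt (0 / \<mu> s)"
        using s by (intro tendsto_intros LIMSEQ_inverse_real_of_nat) auto
      then show "(\<lambda>k. 3 * ?\<eta> k) \<longlonglongrightarrow> 0"
        by simp
      fix k
      have "1 - (\<Sum>\<^sub>\<infinity>g\<in>carrier G. f k g * f k (inv s \<otimes> g)) \<le> inverse (real (Suc k)) / \<mu> s"
        using f(3)[OF s(1), of k] s(2) by (simp add: pos_le_divide_eq mult.commute)
      also have "\<dots> = (?\<eta> k)\<^sup>2"
        using s(2) by simp
      finally have overlap: "1 - (\<Sum>\<^sub>\<infinity>g\<in>carrier G. f k g * f k (inv s \<otimes> g)) \<le> (?\<eta> k)\<^sup>2" .
      have "0 < ?\<eta> k"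
        using s(2) by simp
      note * = almost_invariant_squares[of "f k", OF f(1) f(2) s(1) this overlap]
      show "(\<lambda>g. \<bar>(f k (inv s \<otimes> g))\<^sup>2 - (f k g)\<^sup>2\<bar>) summable_on carrier G"
        by (rule *(1))
      show "(\<Sum>\<^sub>\<infinity>g\<in>carrier G. \<bar>(f k (inv s \<otimes> g))\<^sup>2 - (f k g)\<^sup>2\<bar>) \<le> 3 * ?\<eta> k"
        by (rule *(2))
    qed
  qed (use f in \<open>auto simp: measure_support_def\<close>)
  have "\<forall>F\<in>bounded_functions G. M (\<lambda>x. F (g \<otimes> x)) = M F" if "g \<in> carrier G" for g
    using that
  proof (induction rule: support_induct)
    case (support s)
    then show ?case
      using M by (auto simp: measure_support_def)
  next
    case (mult a b)
    show ?case
    proof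
      fix F assume F: "F \<in> bounded_functions G"
      have Fa: "(\<lambda>x. F (a \<otimes> x)) \<in> bounded_functions G"
        and Fab: "(\<lambda>x. F (a \<otimes> (b \<otimes> x))) \<in> bounded_functions G"
        and Fab': "(\<lambda>x. F (a \<otimes> b \<otimes> x)) \<in> bounded_functions G"
        using F mult(1,2) by (auto simp: bounded_functions_iff)
      have "M (\<lambda>x. F (a \<otimes> b \<otimes> x)) = M (\<lambda>x. F (a \<otimes> (b \<otimes> x)))"
        using mult(1,2) by (intro mean_cong[OF mean Fab' Fab]) (auto simp: m_assoc)
      also have "\<dots> = M F"
        using mult(4)[rule_format, OF Fa] mult(3)[rule_format, OF F] by simp
      finally show "M (\<lambda>x. F (a \<otimes> b \<otimes> x)) = M F" .
    qed
  qed
  then show ?thesis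
    using mean by (auto simp: amenable_def invariant_mean_iff)
qed

end

theorem corollary1p2:
  fixes G :: "('a, 'b) monoid_scheme" and S :: "'a set" and \<mu> :: "'a \<Rightarrow> real" and c :: real
  assumes "group G"
    and "finite_generating_set G S"
    and "prob_measure_on G \<mu>"
    and "nondegenerate G \<mu>"
    and "c > 0"
    and "finite_exponential_moment G S \<mu> c"
  shows "spectral_radius G \<mu> = 1 \<longleftrightarrow> amenable G \<and> centred G S \<mu>"
proof -
  interpret random_walk G \<mu>
    using assms by (simp add: random_walk_def random_walk_axioms_def)
  show ?thesis
  proof
    assume "spectral_radius G \<mu> = 1"
    then show "amenable G \<and> centred G S \<mu>"
      using amenable_of_spectral_radius centred_of_spectral_radius assms by blast
  next
    assume *: "amenable G \<and> centred G S \<mu>"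
    then obtain M where "invariant_mean G M"
      by (auto simp: amenable_def)
    then have "\<not> spectral_radius G \<mu> < 1"
      using * not_centred_of_exponential_decay exponential_decay_of_spectral_radius_less by metis
    then show "spectral_radius G \<mu> = 1"
      using spectral_radius_le_1 by simp
  qed
qed

end
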